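(* Let $\mathbb{D}^n$ be the unit polydisk in $\mathbb{C}^n$, let $\mu:\mathbb{D}^n\to(0,\infty)$ be a weight, let $\psi\in H(\mathbb{D}^n)$ and let $\varphi=(\varphi_1,\dots,\varphi_n)$ be a holomorphic self-map of $\mathbb{D}^n$. Let $W_{\psi,\varphi}f=\psi\,(f\circ\varphi)$. The following are equivalent: (a) $W_{\psi,\varphi}:\mathcal{B}(\mathbb{D}^n)\to H^\infty_\mu(\mathbb{D}^n)$ is compact; (b) $W_{\psi,\varphi}:\mathcal{B}_{0*}(\mathbb{D}^n)\to H^\infty_\mu(\mathbb{D}^n)$ is compact; (c) $\psi\in H^\infty_\mu(\mathbb{D}^n)$ and $$\lim_{\varphi(z)\to\partial\mathbb{D}^n}\tfrac12\mu(z)|\psi(z)|\sum_{j=1}^n\log\frac{1+|\varphi_j(z)|}{1-|\varphi_j(z)|}=0.$$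
   Context: $H(\mathbb{D}^n)$ denotes holomorphic functions $\mathbb{D}^n\to\mathbb{C}$. A weight is a continuous strictly positive function $\mu$; $H^\infty_\mu(\mathbb{D}^n)=\{f\in H(\mathbb{D}^n):\|f\|_{H^\infty_\mu}=\sup_{z}\mu(z)|f(z)|<\infty\}$. The Bergman metric of $\mathbb{D}^n$ is $H_z(u,\bar v)=\sum_{j=1}^n\frac{u_j\bar v_j}{(1-|z_j|^2)^2}$. For $f\in H(\mathbb{D}^n)$, $Q_f(z)=\sup_{u\ne 0}\frac{|\sum_k \partial_k f(z)u_k|}{H_z(u,\bar u)^{1/2}}$, $\beta_f=\sup_z Q_f(z)$, $\mathcal{B}(\mathbb{D}^n)=\{f:\beta_f<\infty\}$ with norm $\|f\|_{\mathcal{B}}=|f(0)|+\beta_f$, and $\mathcal{B}_{0*}(\mathbb{D}^n)=\{f\in\mathcal{B}(\mathbb{D}^n):\lim_{z\to\partial^*\mathbb{D}^n}Q_f(z)=0\}$ with the same norm, where $\partial^*\mathbb{D}^n$ is the distinguished boundary (the torus). The limit in (c) means: for every sequence $(z^{(k)})$ in $\mathbb{D}^n$ with $\varphi(z^{(k)})\to\partial\mathbb{D}^n$ (i.e. $\max_j|\varphi_j(z^{(k)})|\to 1$), the expression tends to $0$. *)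

theory Defs
  imports "HOL-Analysis.Analysis"
begin

definition polydisk :: "(complex^'n::finite) set" where
  "polydisk = {z. \<forall>j. cmod (z $ j) < 1}"

definition holo_pd :: "(complex^'n::finite \<Rightarrow> complex) \<Rightarrow> bool" where
  "holo_pd f \<longleftrightarrow> (\<forall>z\<in>polydisk. \<exists>a::complex^'n.
      (f has_derivative (\<lambda>h. \<Sum>j\<in>UNIV. a $ j * h $ j)) (at z))"

definition pd_partial :: "'n::finite \<Rightarrow> (complex^'n \<Rightarrow> complex) \<Rightarrow> complex^'n \<Rightarrow> complex" where
  "pd_partial k f z = deriv (\<lambda>w. f (\<chi> j. if j = k then w else z $ j)) (z $ k)"

definition bergman_H :: "complex^'n::finite \<Rightarrow> complex^'n \<Rightarrow> real" where
  "bergman_H z u = (\<Sum>j\<in>UNIV. (cmod (u $ j))^2 / (1 - (cmod (z $ j))^2)^2)"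

definition Q_f :: "(complex^'n::finite \<Rightarrow> complex) \<Rightarrow> complex^'n \<Rightarrow> real" where
  "Q_f f z = Sup {cmod (\<Sum>k\<in>UNIV. pd_partial k f z * u $ k) / sqrt (bergman_H z u) | u. u \<noteq> 0}"

definition bloch_space :: "(complex^'n::finite \<Rightarrow> complex) set" where
  "bloch_space = {f. holo_pd f \<and> bdd_above (Q_f f ` polydisk)}"

definition bloch_norm :: "(complex^'n::finite \<Rightarrow> complex) \<Rightarrow> real" where
  "bloch_norm f = cmod (f 0) + (SUP z\<in>polydisk. Q_f f z)"

definition bloch0star :: "(complex^'n::finite \<Rightarrow> complex) set" where
  "bloch0star = {f \<in> bloch_space. \<forall>\<epsilon>>0. \<exists>\<delta>>0. \<forall>z\<in>polydisk.
      (\<forall>j. cmod (z $ j) > 1 - \<delta>) \<longrightarrow> Q_f f z < \<epsilon>}"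

definition is_weight :: "(complex^'n::finite \<Rightarrow> real) \<Rightarrow> bool" where
  "is_weight mu \<longleftrightarrow> continuous_on polydisk mu \<and> (\<forall>z\<in>polydisk. mu z > 0)"

definition Hinf :: "(complex^'n::finite \<Rightarrow> real) \<Rightarrow> (complex^'n \<Rightarrow> complex) set" where
  "Hinf mu = {f. holo_pd f \<and> bdd_above ((\<lambda>z. mu z * cmod (f z)) ` polydisk)}"

definition Hinf_norm :: "(complex^'n::finite \<Rightarrow> real) \<Rightarrow> (complex^'n \<Rightarrow> complex) \<Rightarrow> real" where
  "Hinf_norm mu f = (SUP z\<in>polydisk. mu z * cmod (f z))"

definition holo_selfmap :: "(complex^'n::finite \<Rightarrow> complex^'n) \<Rightarrow> bool" where
  "holo_selfmap phi \<longleftrightarrow> (\<forall>j. holo_pd (\<lambda>z. phi z $ j)) \<and> (\<forall>z\<in>polydisk. phi z \<in> polydisk)"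

definition wcomp :: "(complex^'n::finite \<Rightarrow> complex) \<Rightarrow> (complex^'n \<Rightarrow> complex^'n)
    \<Rightarrow> (complex^'n \<Rightarrow> complex) \<Rightarrow> (complex^'n \<Rightarrow> complex)" where
  "wcomp psi phi f = (\<lambda>z. psi z * f (phi z))"

text \<open>Compact operator T : (X, nX) \<rightarrow> (Y, nY) between normed function spaces:
  T maps X into Y and the image of the closed unit ball is relatively compact,
  expressed sequentially (every sequence in the unit ball has a subsequence whose
  image converges in Y).\<close>
definition compact_op :: "('a \<Rightarrow> complex) set \<Rightarrow> (('a \<Rightarrow> complex) \<Rightarrow> real)
    \<Rightarrow> ('a \<Rightarrow> complex) set \<Rightarrow> (('a \<Rightarrow> complex) \<Rightarrow> real)
    \<Rightarrow> (('a \<Rightarrow> complex) \<Rightarrow> ('a \<Rightarrow> complex)) \<Rightarrow> bool" where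
  "compact_op X nX Y nY T \<longleftrightarrow> (\<forall>f\<in>X. T f \<in> Y) \<and>
     (\<forall>s. (\<forall>m. s m \<in> X \<and> nX (s m) \<le> 1) \<longrightarrow>
        (\<exists>(r::nat \<Rightarrow> nat) g. strict_mono r \<and> g \<in> Y \<and>
           (\<lambda>m. nY (\<lambda>z. T (s (r m)) z - g z)) \<longlonglongrightarrow> 0))"

end

theory Submission
  imports Defs "HOL-Complex_Analysis.Great_Picard"
begin

text \<open>
  Write \<open>L z = 1/2 (\<Sum>j. log ((1 + |z\<^sub>j|) / (1 - |z\<^sub>j|)))\<close>. Integrating along the segment from \<open>0\<close>
  to \<open>z\<close> gives the growth estimate \<open>|f z| \<le> \<parallel>f\<parallel> (1 + L z)\<close>, and the unit ball of the Bloch space is a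
  normal family. If (c) holds, a sequence in the ball has a locally uniformly convergent subsequence
  \<open>f\<^sub>m \<rightarrow> g\<close>; the weighted difference is small where \<open>\<phi>(z)\<close> stays in a compact set by uniform
  convergence, and elsewhere by the growth estimate together with (c). The limit \<open>g\<close> need not be
  shown to be a Bloch function, since only its growth bound matters.

  Conversely, given points \<open>s\<^sub>k\<close> with \<open>\<phi>(s\<^sub>k)\<close> tending to the boundary, let \<open>w\<^sub>k\<close> be the coordinate of
  \<open>\<phi>(s\<^sub>k)\<close> of largest modulus. The functions \<open>Ln (1 - cnj w\<^sub>k z\<^sub>j)\<^sup>2 / (- ln (1 - |w\<^sub>k|\<^sup>2))\<close> of this one
  coordinate are bounded in the little-star Bloch space and tend to \<open>0\<close> pointwise, while at
  \<open>\<phi>(s\<^sub>k)\<close> they are comparable to \<open>L (\<phi>(s\<^sub>k))\<close>.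
\<close>

section \<open>Partial derivatives on the polydisk\<close>

text \<open>The map under \<open>deriv\<close> in \<open>pd_partial\<close>: it turns a function on
  the polydisk into a function of one complex variable.\<close>

definition slice :: "'n::finite \<Rightarrow> complex^'n \<Rightarrow> complex \<Rightarrow> complex^'n" where
  "slice k z w = (\<chi> j. if j = k then w else z $ j)"

lemma slice_nth: "slice k z w $ j = (if j = k then w else z $ j)"
  by (simp add: slice_def)

lemma slice_same [simp]: "slice k z (z $ k) = z"
  by (simp add: slice_def vec_eq_iff)

lemma slice_has_derivative: "(slice k z has_derivative axis k) (at w)"
proof -
  have bl: "bounded_linear (axis k :: complex \<Rightarrow> complex^'a)"
    by (intro linear_conv_bounded_linear[THEN iffD1] linearI) (auto simp: axis_def vec_eq_iff)
  have "slice k z = (\<lambda>w. slice k z 0 + axis k w)"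
    by (auto simp: slice_def axis_def vec_eq_iff fun_eq_iff)
  moreover have "((\<lambda>w. slice k z 0 + axis k w) has_derivative axis k) (at w)"
    using has_derivative_add[OF has_derivative_const bounded_linear.has_derivative[OF bl has_derivative_ident]]
    by simp
  ultimately show ?thesis by simp
qed

lemma slice_has_field_derivative:
  assumes "(f has_derivative (\<lambda>h. \<Sum>j\<in>UNIV. a $ j * h $ j)) (at (slice k z w))"
  shows "((\<lambda>w. f (slice k z w)) has_field_derivative a $ k) (at w)"
proof -
  have "((\<lambda>w. f (slice k z w)) has_derivative (\<lambda>h. \<Sum>j\<in>UNIV. a $ j * axis k h $ j)) (at w)"
    using diff_chain_at[OF slice_has_derivative assms] by (simp add: o_def)
  moreover have "(\<Sum>j\<in>UNIV. a $ j * axis k h $ j) = a $ k * h" for h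
    by (simp add: axis_def if_distrib cong: if_cong)
  ultimately show ?thesis
    by (simp add: has_field_derivative_def)
qed

text \<open>Restriction to a coordinate line shows that the coefficients of a complex-linear
  derivative must be the partial derivatives. The existential in \<open>holo_pd\<close> thereby gets
  a canonical witness.\<close>

lemma pd_partial_eqI:
  assumes "(f has_derivative (\<lambda>h. \<Sum>j\<in>UNIV. a $ j * h $ j)) (at z)"
  shows "pd_partial k f z = a $ k"
  using slice_has_field_derivative[of f a k z "z $ k"] assms
  by (auto simp: pd_partial_def slice_def[symmetric] intro: DERIV_imp_deriv)

lemma holo_pd_has_derivative:
  assumes "holo_pd f" "z \<in> polydisk"
  shows "(f has_derivative (\<lambda>h. \<Sum>j\<in>UNIV. pd_partial j f z * h $ j)) (at z)"
proof -
  obtain a where a: "(f has_derivative (\<lambda>h. \<Sum>j\<in>UNIV. a $ j * h $ j)) (at z)"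
    using assms by (auto simp: holo_pd_def)
  show ?thesis using a by (simp add: pd_partial_eqI[OF a])
qed

lemma holo_pdI:
  assumes "\<And>z. z \<in> polydisk \<Longrightarrow> (f has_derivative (\<lambda>h. \<Sum>j\<in>UNIV. p z j * h $ j)) (at z)"
  shows "holo_pd f"
  unfolding holo_pd_def
proof
  fix z :: "complex^'a" assume "z \<in> polydisk"
  from assms[OF this] show "\<exists>a. (f has_derivative (\<lambda>h. \<Sum>j\<in>UNIV. a $ j * h $ j)) (at z)"
    by (intro exI[of _ "\<chi> j. p z j"]) simp
qed

lemma holo_pd_slice:
  assumes "holo_pd f" "slice k z w \<in> polydisk"
  shows "((\<lambda>w. f (slice k z w)) has_field_derivative pd_partial k f (slice k z w)) (at w)"
  using slice_has_field_derivative[of f "\<chi> j. pd_partial j f (slice k z w)"]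
    holo_pd_has_derivative[OF assms] by simp

section \<open>Closure properties of holomorphic functions\<close>

lemma holo_pd_const [simp]: "holo_pd (\<lambda>_. c)"
  by (rule holo_pdI[where p = "\<lambda>_ _. 0"]) simp

lemma holo_pd_diff:
  assumes "holo_pd f" "holo_pd g"
  shows "holo_pd (\<lambda>z. f z - g z)"
  by (rule holo_pdI[where p = "\<lambda>z j. pd_partial j f z - pd_partial j g z"])
     (use has_derivative_diff[OF assms[THEN holo_pd_has_derivative]] in
       \<open>simp add: sum_subtractf left_diff_distrib\<close>)

lemma pd_partial_diff:
  assumes "holo_pd f" "holo_pd g" "z \<in> polydisk"
  shows "pd_partial k (\<lambda>z. f z - g z) z = pd_partial k f z - pd_partial k g z"
  using pd_partial_eqI[of "\<lambda>z. f z - g z" "\<chi> j. pd_partial j f z - pd_partial j g z" z k]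
    has_derivative_diff[OF assms(1,2)[THEN holo_pd_has_derivative, OF assms(3)]]
  by (simp add: sum_subtractf left_diff_distrib)

lemma holo_pd_mult:
  assumes "holo_pd f" "holo_pd g"
  shows "holo_pd (\<lambda>z. f z * g z)"
  by (rule holo_pdI[where p = "\<lambda>z j. f z * pd_partial j g z + pd_partial j f z * g z"])
     (use has_derivative_mult[OF assms[THEN holo_pd_has_derivative]] in
       \<open>simp add: sum.distrib sum_distrib_left sum_distrib_right algebra_simps\<close>)

lemma holo_pd_coord:
  assumes "\<And>w. cmod w < 1 \<Longrightarrow> (h has_field_derivative h' w) (at w)" "z \<in> polydisk"
  shows "((\<lambda>z. h (z $ i)) has_derivative (\<lambda>u. \<Sum>j\<in>UNIV. (if j = i then h' (z $ i) else 0) * u $ j)) (at z)"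
proof -
  have "((\<lambda>z. z $ i) has_derivative (\<lambda>u. u $ i)) (at z)"
    by (rule bounded_linear.has_derivative[OF bounded_linear_vec_nth has_derivative_ident])
  moreover have "(h has_derivative (\<lambda>u. h' (z $ i) * u)) (at (z $ i))"
    using assms by (simp add: has_field_derivative_def polydisk_def)
  ultimately have "((\<lambda>z. h (z $ i)) has_derivative (\<lambda>u. h' (z $ i) * u $ i)) (at z)"
    using diff_chain_at[of "\<lambda>z. z $ i" "\<lambda>u. u $ i" z h] by (simp add: o_def)
  moreover have "(\<Sum>j\<in>UNIV. (if j = i then h' (z $ i) else 0) * u $ j) = h' (z $ i) * u $ i" for u :: "complex^'a"
    by (simp add: if_distrib if_distribR cong: if_cong)
  ultimately show ?thesis by simp
qed

text \<open>A basis vector has the form \<open>axis i u\<close>, and the inner product with it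
  depends on coordinate \<open>i\<close> only.\<close>

lemma has_derivative_vec:
  fixes f :: "'a::real_normed_vector \<Rightarrow> 'b::euclidean_space^'n"
  assumes "\<And>i. ((\<lambda>x. f x $ i) has_derivative (\<lambda>h. f' h $ i)) (at x within S)"
  shows "(f has_derivative f') (at x within S)"
  unfolding has_derivative_componentwise_within[of f]
proof
  fix b :: "'b^'n" assume "b \<in> Basis"
  then obtain i u where b: "b = axis i u" by (auto simp: Basis_vec_def)
  show "((\<lambda>x. f x \<bullet> b) has_derivative (\<lambda>x. f' x \<bullet> b)) (at x within S)"
    unfolding b inner_axis by (intro has_derivative_inner_left assms)
qed

lemma holo_pd_compose:
  assumes "holo_pd f" "holo_selfmap phi"
  shows "holo_pd (\<lambda>z. f (phi z))"
proof (rule holo_pdI)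
  fix z :: "complex^'a" assume z: "z \<in> polydisk"
  let ?p = "\<lambda>j k. pd_partial k (\<lambda>z. phi z $ j) z"
  have "((\<lambda>z. phi z $ j) has_derivative (\<lambda>h. \<Sum>k\<in>UNIV. ?p j k * h $ k)) (at z)" for j
    using assms z by (intro holo_pd_has_derivative) (auto simp: holo_selfmap_def)
  then have d1: "(phi has_derivative (\<lambda>h. \<chi> j. \<Sum>k\<in>UNIV. ?p j k * h $ k)) (at z)"
    by (intro has_derivative_vec) simp
  have d2: "(f has_derivative (\<lambda>h. \<Sum>j\<in>UNIV. pd_partial j f (phi z) * h $ j)) (at (phi z))"
    using assms z by (intro holo_pd_has_derivative) (auto simp: holo_selfmap_def)
  have "((\<lambda>z. f (phi z)) has_derivative
     (\<lambda>h. \<Sum>j\<in>UNIV. pd_partial j f (phi z) * (\<Sum>k\<in>UNIV. ?p j k * h $ k))) (at z)"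
    using diff_chain_at[OF d1 d2] by (simp add: o_def)
  moreover have "(\<Sum>j\<in>UNIV. pd_partial j f (phi z) * (\<Sum>k\<in>UNIV. ?p j k * h $ k)) =
      (\<Sum>k\<in>UNIV. (\<Sum>j\<in>UNIV. pd_partial j f (phi z) * ?p j k) * h $ k)" for h :: "complex^'a"
    unfolding sum_distrib_left sum_distrib_right by (subst sum.swap) (simp add: mult.assoc)
  ultimately show "((\<lambda>z. f (phi z)) has_derivative
      (\<lambda>h. \<Sum>k\<in>UNIV. (\<Sum>j\<in>UNIV. pd_partial j f (phi z) * ?p j k) * h $ k)) (at z)"
    by simp
qed

section \<open>Growth of Bloch functions\<close>

text \<open>As a weighted Euclidean norm, the Bergman length lies between the maximum and the sum of
  the weighted moduli. Both comparisons are used below.\<close>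

lemma bergman_H_L2: "sqrt (bergman_H z u) = L2_set (\<lambda>j. cmod (u $ j) / (1 - (cmod (z $ j))\<^sup>2)) UNIV"
  by (simp add: bergman_H_def L2_set_def power_divide)

lemma one_minus_square_pos: "z \<in> polydisk \<Longrightarrow> 0 < 1 - (cmod (z $ j))\<^sup>2"
  by (simp add: polydisk_def abs_square_less_1)

lemma bergman_component:
  "z \<in> polydisk \<Longrightarrow> cmod (u $ j) / (1 - (cmod (z $ j))\<^sup>2) \<le> sqrt (bergman_H z u)"
  unfolding bergman_H_L2 by (rule member_le_L2_set) auto

lemma bergman_component':
  assumes "z \<in> polydisk"
  shows "cmod (u $ j) \<le> (1 - (cmod (z $ j))\<^sup>2) * sqrt (bergman_H z u)"
  using bergman_component[OF assms, of u j] one_minus_square_pos[OF assms, of j]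
  by (simp add: divide_le_eq mult.commute)

lemma bergman_H_pos: "z \<in> polydisk \<Longrightarrow> u \<noteq> 0 \<Longrightarrow> 0 < sqrt (bergman_H z u)"
proof -
  assume z: "z \<in> polydisk" and "u \<noteq> 0"
  then obtain j where "u $ j \<noteq> 0" by (auto simp: vec_eq_iff)
  then have "0 < cmod (u $ j) / (1 - (cmod (z $ j))\<^sup>2)" using one_minus_square_pos[OF z] by simp
  with bergman_component[OF z, of u j] show ?thesis by linarith
qed

text \<open>A crude bound from \<open>1 - |z $ k|^2 \<le> 1\<close>. It makes the set in
  \<open>Q_f\<close> bounded, so that its \<open>Sup\<close> is a genuine supremum.\<close>

lemma linear_form_le_bergman:
  assumes z: "z \<in> polydisk"
  shows "cmod (\<Sum>k\<in>UNIV. p k * u $ k) \<le> (\<Sum>k\<in>UNIV. cmod (p k)) * sqrt (bergman_H z u)"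
proof -
  have "cmod (u $ k) \<le> sqrt (bergman_H z u)" for k
  proof -
    have "(1 - (cmod (z $ k))\<^sup>2) * sqrt (bergman_H z u) \<le> 1 * sqrt (bergman_H z u)"
      by (intro mult_right_mono) (auto simp: bergman_H_def intro: sum_nonneg)
    with bergman_component'[OF z, of u k] show ?thesis by linarith
  qed
  then show ?thesis
    unfolding sum_distrib_right
    by (intro order_trans[OF norm_sum] sum_mono) (simp add: norm_mult mult_left_mono)
qed

lemma le_Q_f:
  assumes z: "z \<in> polydisk"
  shows "cmod (\<Sum>k\<in>UNIV. pd_partial k f z * u $ k) \<le> Q_f f z * sqrt (bergman_H z u)"
proof (cases "u = 0")
  case True then show ?thesis by (simp add: bergman_H_def)
next
  case False
  have "cmod (\<Sum>k\<in>UNIV. pd_partial k f z * u $ k) / sqrt (bergman_H z u) \<le> Q_f f z"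
    unfolding Q_f_def
  proof (rule cSup_upper)
    show "bdd_above {cmod (\<Sum>k\<in>UNIV. pd_partial k f z * u $ k) / sqrt (bergman_H z u) |u. u \<noteq> 0}"
      using linear_form_le_bergman[OF z] bergman_H_pos[OF z]
      by (auto intro!: bdd_aboveI[where M = "\<Sum>k\<in>UNIV. cmod (pd_partial k f z)"] simp: divide_le_eq)
  qed (use False in auto)
  then show ?thesis using bergman_H_pos[OF z False] by (simp add: divide_le_eq)
qed

lemma Q_f_le:
  assumes z: "z \<in> polydisk"
    and M: "\<And>u. cmod (\<Sum>k\<in>UNIV. pd_partial k f z * u $ k) \<le> M * sqrt (bergman_H z u)"
  shows "Q_f f z \<le> M"
  unfolding Q_f_def
proof (rule cSup_least)
  \<comment> \<open>Any index yields a nonzero direction, so the supremum runs over a nonempty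
    set.\<close>
  have "axis undefined (1::complex) \<noteq> 0" by (simp add: axis_eq_0_iff)
  then show "{cmod (\<Sum>k\<in>UNIV. pd_partial k f z * u $ k) / sqrt (bergman_H z u) |u. u \<noteq> 0} \<noteq> {}"
    by blast
qed (use M bergman_H_pos[OF z] in \<open>auto simp: divide_le_eq\<close>)

lemma Q_f_nonneg:
  assumes z: "z \<in> polydisk"
  shows "0 \<le> Q_f f z"
proof -
  have "0 < sqrt (bergman_H z (axis undefined 1))"
    by (rule bergman_H_pos[OF z]) (simp add: axis_eq_0_iff)
  moreover have "0 \<le> Q_f f z * sqrt (bergman_H z (axis undefined 1))"
    by (rule order_trans[OF norm_ge_zero le_Q_f[OF z]])
  ultimately show ?thesis by (simp add: zero_le_mult_iff)
qed

section \<open>Estimates by the Bloch norm\<close>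

lemma zero_in_polydisk [simp]: "0 \<in> polydisk"
  by (simp add: polydisk_def)

lemma Q_f_le_bloch_norm:
  assumes "f \<in> bloch_space" "z \<in> polydisk"
  shows "Q_f f z \<le> bloch_norm f"
proof -
  have "Q_f f z \<le> (SUP z\<in>polydisk. Q_f f z)"
    using assms by (intro cSUP_upper) (auto simp: bloch_space_def)
  then show ?thesis by (simp add: bloch_norm_def add_increasing)
qed

lemma cmod_0_le_bloch_norm:
  assumes "f \<in> bloch_space"
  shows "cmod (f 0) \<le> bloch_norm f"
proof -
  have "Q_f f 0 \<le> (SUP z\<in>polydisk. Q_f f z)"
    using assms by (intro cSUP_upper) (auto simp: bloch_space_def)
  with Q_f_nonneg[of 0 f] show ?thesis by (simp add: bloch_norm_def)
qed

text \<open>The Euclidean norm is weakened to the sum of the coordinates because the sum can be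
  integrated one coordinate at a time.\<close>

lemma bloch_partial_bound:
  assumes "f \<in> bloch_space" "z \<in> polydisk"
  shows "cmod (\<Sum>k\<in>UNIV. pd_partial k f z * u $ k) \<le>
    bloch_norm f * (\<Sum>j\<in>UNIV. cmod (u $ j) / (1 - (cmod (z $ j))\<^sup>2))"
proof -
  have "sqrt (bergman_H z u) \<le> (\<Sum>j\<in>UNIV. cmod (u $ j) / (1 - (cmod (z $ j))\<^sup>2))"
    unfolding bergman_H_L2 using one_minus_square_pos[OF assms(2)]
    by (intro L2_set_le_sum) (auto simp: less_imp_le)
  moreover have "0 \<le> bloch_norm f"
    using cmod_0_le_bloch_norm[OF assms(1)] norm_ge_zero order_trans by blast
  moreover have "0 \<le> sqrt (bergman_H z u)"
    by (auto simp: bergman_H_def intro: sum_nonneg)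
  ultimately show ?thesis
    using le_Q_f[OF assms(2), of f u] Q_f_le_bloch_norm[OF assms]
    by (meson mult_mono order_trans)
qed

text \<open>Each summand, halved, is artanh of \<open>cmod (z $ j)\<close>, the hyperbolic distance
  from 0 to \<open>z $ j\<close> for the metric |dz| / (1 - |z|^2).\<close>

definition bloch_log :: "complex^'n::finite \<Rightarrow> real" where
  "bloch_log z = (\<Sum>j\<in>UNIV. ln ((1 + cmod (z $ j)) / (1 - cmod (z $ j)))) / 2"

lemma ln_cayley_derivative:
  fixes t a :: real
  assumes "0 \<le> t" "t \<le> 1" "0 \<le> a" "a < 1"
  shows "((\<lambda>t. ln ((1 + t * a) / (1 - t * a)) / 2) has_real_derivative a / (1 - (t * a)\<^sup>2)) (at t)"
proof -
  have "t * a \<le> 1 * a" using assms by (intro mult_right_mono) auto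
  then have "t * a < 1" "0 \<le> t * a" using assms by auto
  moreover from this have "(t * a)\<^sup>2 < 1" by (simp add: abs_square_less_1)
  moreover have "1 - (t*a)\<^sup>2 = (1 - t * a) * (1 + t * a)" by (simp add: power2_eq_square algebra_simps)
  ultimately show ?thesis
    by (auto intro!: derivative_eq_intros simp: divide_simps) (simp add: algebra_simps)
qed

lemma bloch_growth:
  assumes f: "f \<in> bloch_space" and z: "z \<in> polydisk"
  shows "cmod (f z) \<le> bloch_norm f * (1 + bloch_log z)"
proof -
  have z1: "cmod (z $ j) < 1" for j using z by (simp add: polydisk_def)
  let ?phi = "\<lambda>t::real. bloch_norm f * (\<Sum>j\<in>UNIV. ln ((1 + t * cmod (z $ j)) / (1 - t * cmod (z $ j))) / 2)"
  let ?phi' = "\<lambda>t::real. bloch_norm f * (\<Sum>j\<in>UNIV. cmod (z $ j) / (1 - (t * cmod (z $ j))\<^sup>2))"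
  have tz: "t *\<^sub>R z \<in> polydisk" if "0 \<le> t" "t \<le> 1" for t
  proof -
    have "cmod ((t *\<^sub>R z) $ j) < 1" for j
      using z1[of j] that mult_left_le_one_le[of "cmod (z $ j)" t] by simp
    then show ?thesis by (simp add: polydisk_def)
  qed
  have d1: "((\<lambda>t. f (t *\<^sub>R z)) has_vector_derivative (\<Sum>k\<in>UNIV. pd_partial k f (t *\<^sub>R z) * z $ k)) (at t)"
    if t: "0 \<le> t" "t \<le> 1" for t
  proof -
    have "(f has_derivative (\<lambda>h. \<Sum>k\<in>UNIV. pd_partial k f (t *\<^sub>R z) * h $ k)) (at (t *\<^sub>R z))"
      using f tz[OF t] by (intro holo_pd_has_derivative) (auto simp: bloch_space_def)
    moreover have "((\<lambda>t. t *\<^sub>R z) has_derivative (\<lambda>h. h *\<^sub>R z)) (at t)"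
      by (auto intro!: derivative_eq_intros)
    ultimately have "((\<lambda>t. f (t *\<^sub>R z)) has_derivative (\<lambda>h. \<Sum>k\<in>UNIV. pd_partial k f (t *\<^sub>R z) * (h *\<^sub>R z) $ k)) (at t)"
      by (rule has_derivative_compose[rotated])
    then show ?thesis by (simp add: has_vector_derivative_def scaleR_sum_right)
  qed
  have d2: "(?phi has_vector_derivative ?phi' t) (at t)" if t: "0 \<le> t" "t \<le> 1" for t
    unfolding has_real_derivative_iff_has_vector_derivative[symmetric]
    by (intro DERIV_cmult DERIV_sum ln_cayley_derivative t norm_ge_zero z1)
  \<comment> \<open>Mean value inequality: along the radius the derivative of \<open>f\<close> is
    dominated by that of the real function \<open>?phi\<close>, hence so is its increment.\<close>
  have "cmod (f (1 *\<^sub>R z) - f (0 *\<^sub>R z)) \<le> ?phi 1 - ?phi 0"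
  proof (rule differentiable_bound_general[where f' = "\<lambda>t. \<Sum>k\<in>UNIV. pd_partial k f (t *\<^sub>R z) * z $ k"])
    show "continuous_on {0..1} (\<lambda>t. f (t *\<^sub>R z))"
      by (intro continuous_at_imp_continuous_on ballI has_vector_derivative_continuous[OF d1]) auto
    show "continuous_on {0..1} ?phi"
      by (intro continuous_at_imp_continuous_on ballI has_vector_derivative_continuous[OF d2]) auto
    show "cmod (\<Sum>k\<in>UNIV. pd_partial k f (t *\<^sub>R z) * z $ k) \<le> ?phi' t" if "0 < t" "t < 1" for t
      using bloch_partial_bound[OF f tz, of t z] that by simp
  qed (use d1 d2 in auto)
  also have "?phi 1 - ?phi 0 = bloch_norm f * bloch_log z"
    by (simp add: bloch_log_def sum_divide_distrib)
  finally have "cmod (f z - f 0) \<le> bloch_norm f * bloch_log z" by simp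
  \<comment> \<open>The summand 1 in the growth factor pays for \<open>f 0\<close>.\<close>
  with cmod_0_le_bloch_norm[OF f] norm_triangle_ineq2[of "f z" "f 0"] show ?thesis
    by (simp add: algebra_simps)
qed

section \<open>Normality of the Bloch ball\<close>

text \<open>For \<open>r < 1\<close> these sets form a convex, compact exhaustion of the polydisk;
  locally uniform convergence is tested on them.\<close>

definition closed_pd :: "real \<Rightarrow> (complex^'n::finite) set" where
  "closed_pd r = {z. \<forall>j. cmod (z $ j) \<le> r}"

lemma closed_pd_subset: "r < 1 \<Longrightarrow> closed_pd r \<subseteq> polydisk"
  by (auto simp: closed_pd_def polydisk_def intro: le_less_trans)

lemma closed_pd_mono: "r \<le> r' \<Longrightarrow> closed_pd r \<subseteq> closed_pd r'"
  by (auto simp: closed_pd_def intro: order_trans)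

lemma compact_closed_pd: "compact (closed_pd r :: (complex^'n::finite) set)"
proof -
  have "norm z \<le> CARD('n) * r" if "z \<in> closed_pd r" for z :: "complex^'n"
  proof -
    have "norm z \<le> (\<Sum>j\<in>UNIV. cmod (z $ j))"
      unfolding norm_vec_def by (rule L2_set_le_sum) auto
    also have "\<dots> \<le> (\<Sum>j\<in>(UNIV::'n set). r)"
      using that by (intro sum_mono) (simp add: closed_pd_def)
    finally show ?thesis by simp
  qed
  then have "bounded (closed_pd r :: (complex^'n) set)"
    by (auto simp: bounded_iff)
  moreover have "closed (closed_pd r :: (complex^'n) set)"
    unfolding closed_pd_def
    by (intro closed_Collect_all closed_Collect_le continuous_intros)
  ultimately show ?thesis by (simp add: compact_eq_bounded_closed)
qed

lemma convex_closed_pd: "convex (closed_pd r)"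
proof (rule convexI)
  fix x y :: "complex^'n::finite" and u v :: real
  assume a: "x \<in> closed_pd r" "y \<in> closed_pd r" "0 \<le> u" "0 \<le> v" "u + v = 1"
  have "cmod ((u *\<^sub>R x + v *\<^sub>R y) $ j) \<le> r" for j
  proof -
    have "cmod ((u *\<^sub>R x + v *\<^sub>R y) $ j) \<le> u * cmod (x $ j) + v * cmod (y $ j)"
      using norm_triangle_ineq[of "u *\<^sub>R (x $ j)" "v *\<^sub>R (y $ j)"] a by simp
    also have "\<dots> \<le> u * r + v * r"
      using a by (intro add_mono mult_left_mono) (auto simp: closed_pd_def)
    finally show ?thesis using a by (simp flip: distrib_right)
  qed
  then show "u *\<^sub>R x + v *\<^sub>R y \<in> closed_pd r" by (simp add: closed_pd_def)
qed

text \<open>Any radius strictly between the largest modulus of a coordinate and 1 will do. At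
  interior points a derivative within \<open>closed_pd r\<close> is a full derivative.\<close>

lemma polydisk_interior_closed_pd:
  assumes "z \<in> polydisk"
  obtains r where "0 < r" "r < 1" "z \<in> interior (closed_pd r)"
proof -
  define m where "m = Max (range (\<lambda>j. cmod (z $ j)))"
  have m: "cmod (z $ j) \<le> m" for j by (simp add: m_def)
  have "m \<in> range (\<lambda>j. cmod (z $ j))" unfolding m_def by (intro Max_in) auto
  then have "m < 1" "0 \<le> m" using assms by (auto simp: polydisk_def)
  then obtain r where r: "m < r" "r < 1" using dense by blast
  have "open {x::complex^'a. \<forall>j. cmod (x $ j) < r}"
    unfolding Collect_all_eq by (intro open_INT ballI open_Collect_less continuous_intros) auto
  moreover have "{x::complex^'a. \<forall>j. cmod (x $ j) < r} \<subseteq> closed_pd r"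
    by (auto simp: closed_pd_def less_imp_le)
  moreover have "z \<in> {x. \<forall>j. cmod (x $ j) < r}" using m r by (auto intro: le_less_trans)
  ultimately show thesis
    using r \<open>0 \<le> m\<close> by (intro that[of r]) (auto intro: interiorI)
qed

text \<open>If coordinate \<open>k\<close> moves over the closed disk of radius
  \<open>r' - r\<close> about \<open>z $ k\<close>, the point stays in \<open>closed_pd r'\<close>.
  The one-variable Cauchy inequality for the first derivative then applies to the slice.\<close>

lemma Cauchy_estimate_pd:
  fixes f :: "complex^'n::finite \<Rightarrow> complex"
  assumes f: "holo_pd f" and r: "r < r'" "r' < 1" and z: "z \<in> closed_pd r"
    and B: "\<And>x. x \<in> closed_pd r' \<Longrightarrow> cmod (f x) \<le> B"
  shows "cmod (pd_partial k f z) \<le> B / (r' - r)"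
proof -
  let ?g = "\<lambda>w. f (slice k z w)"
  have sl: "slice k z w \<in> closed_pd r'" if "w \<in> cball (z $ k) (r' - r)" for w
  proof -
    have "cmod w \<le> cmod (z $ k) + (r' - r)"
      using that norm_triangle_sub[of w "z $ k"] by (simp add: dist_norm norm_minus_commute)
    moreover have "cmod (z $ j) \<le> r" for j using z by (simp add: closed_pd_def)
    ultimately show ?thesis
      using r by (auto simp: closed_pd_def slice_nth intro: order_trans[of _ r] dest: spec[of _ k])
         (smt (verit, best))+
  qed
  have d: "(?g has_field_derivative pd_partial k f (slice k z w)) (at w)"
    if "w \<in> cball (z $ k) (r' - r)" for w
    using sl[OF that] closed_pd_subset[OF r(2)] by (intro holo_pd_slice[OF f]) auto
  have "cmod ((deriv ^^ 1) ?g (z $ k)) \<le> fact 1 * B / (r' - r) ^ 1"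
  proof (rule Cauchy_inequality)
    show "?g holomorphic_on ball (z $ k) (r' - r)"
    proof (rule holomorphic_onI)
      fix w assume "w \<in> ball (z $ k) (r' - r)"
      then have "w \<in> cball (z $ k) (r' - r)" by simp
      then show "?g field_differentiable at w within ball (z $ k) (r' - r)"
        using has_field_derivative_at_within[OF d] unfolding field_differentiable_def by metis
    qed
    show "continuous_on (cball (z $ k) (r' - r)) ?g"
      by (intro continuous_at_imp_continuous_on ballI DERIV_isCont[OF d])
    show "cmod (f (slice k z w)) \<le> B" if "cmod (z $ k - w) = r' - r" for w
      by (rule B, rule sl) (use that in \<open>simp add: dist_norm\<close>)
  qed (use r in simp)
  then show ?thesis by (simp add: pd_partial_def slice_def)
qed

text \<open>By Cauchy's estimate in each variable separately, the partial derivatives also converge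
  locally uniformly.\<close>

lemma holo_pd_uniform_limit:
  fixes F :: "nat \<Rightarrow> complex^'n::finite \<Rightarrow> complex"
  assumes F: "\<And>n. holo_pd (F n)"
    and lim: "\<And>r. r < 1 \<Longrightarrow> uniform_limit (closed_pd r) F g sequentially"
  shows "holo_pd g"
  unfolding holo_pd_def
proof
  fix z :: "complex^'n" assume "z \<in> polydisk"
  then obtain r where r: "0 < r" "r < 1" "z \<in> interior (closed_pd r)"
    by (rule polydisk_interior_closed_pd)
  obtain r' where r': "r < r'" "r' < 1" using dense r by blast
  have "\<exists>l. uniform_limit (closed_pd r) (\<lambda>n. pd_partial k (F n)) l sequentially" for k
  proof -
    have "uniformly_Cauchy_on (closed_pd r) (\<lambda>n. pd_partial k (F n))"
      unfolding uniformly_Cauchy_on_def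
    proof (intro allI impI)
      fix e :: real assume e: "0 < e"
      have "uniformly_Cauchy_on (closed_pd r') F"
        using lim[OF r'(2)] uniformly_convergent_Cauchy uniformly_convergent_on_def by blast
      \<comment> \<open>With this tolerance on the larger polydisk, Cauchy's estimate leaves
        \<open>e / 2\<close> on the smaller one.\<close>
      moreover have "0 < e * (r' - r) / 2" using e r' by simp
      ultimately obtain M where M: "\<And>x m n. x \<in> closed_pd r' \<Longrightarrow> m \<ge> M \<Longrightarrow> n \<ge> M \<Longrightarrow>
          dist (F m x) (F n x) < e * (r' - r) / 2"
        unfolding uniformly_Cauchy_on_def by meson
      have "dist (pd_partial k (F m) x) (pd_partial k (F n) x) < e"
        if x: "x \<in> closed_pd r" and mn: "m \<ge> M" "n \<ge> M" for x m n
      proof -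
        have "cmod (pd_partial k (\<lambda>z. F m z - F n z) x) \<le> (e * (r' - r) / 2) / (r' - r)"
          using M mn by (intro Cauchy_estimate_pd holo_pd_diff F r' x) (auto simp: dist_norm less_imp_le)
        moreover have "x \<in> polydisk" using x closed_pd_subset[OF r(2)] by blast
        moreover have "(e * (r' - r) / 2) / (r' - r) = e / 2" using r' by (simp add: divide_simps)
        ultimately show ?thesis using e by (simp add: pd_partial_diff F dist_norm)
      qed
      then show "\<exists>M. \<forall>x\<in>closed_pd r. \<forall>m\<ge>M. \<forall>n\<ge>M. dist (pd_partial k (F m) x) (pd_partial k (F n) x) < e"
        by blast
    qed
    then show ?thesis
      using Cauchy_uniformly_convergent uniformly_convergent_on_def by blast
  qed
  then obtain p where p: "\<And>k. uniform_limit (closed_pd r) (\<lambda>n. pd_partial k (F n)) (p k) sequentially"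
    by metis
  let ?F' = "\<lambda>n x h. \<Sum>k\<in>UNIV. pd_partial k (F n) x * h $ k"
  let ?g' = "\<lambda>x h. \<Sum>k\<in>UNIV. p k x * h $ k"
  have "\<exists>g0. \<forall>x\<in>closed_pd r. (\<lambda>n. F n x) \<longlonglongrightarrow> g0 x \<and> (g0 has_derivative ?g' x) (at x within closed_pd r)"
  proof (rule has_derivative_sequence)
    show "(F n has_derivative ?F' n x) (at x within closed_pd r)" if "x \<in> closed_pd r" for n x
      by (rule has_derivative_at_withinI[OF holo_pd_has_derivative[OF F]])
         (use that closed_pd_subset[OF r(2)] in auto)
    show "\<forall>\<^sub>F n in sequentially. \<forall>x\<in>closed_pd r. \<forall>h. norm (?F' n x h - ?g' x h) \<le> e * norm h"
      if e: "0 < e" for e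
    proof -
      \<comment> \<open>The error is shared among the \<open>CARD('n)\<close> coordinates.\<close>
      have "\<forall>\<^sub>F n in sequentially. \<forall>k. \<forall>x\<in>closed_pd r. dist (pd_partial k (F n) x) (p k x) < e / CARD('n)"
        using p e by (intro eventually_all_finite) (auto simp: uniform_limit_iff)
      then show ?thesis
      proof eventually_elim
        case (elim n)
        show ?case
        proof (intro ballI allI)
          fix x h :: "complex^'n" assume x: "x \<in> closed_pd r"
          have "norm (?F' n x h - ?g' x h) = cmod (\<Sum>k\<in>UNIV. (pd_partial k (F n) x - p k x) * h $ k)"
            by (simp add: sum_subtractf left_diff_distrib)
          also have "\<dots> \<le> (\<Sum>k\<in>(UNIV::'n set). e / CARD('n) * norm h)"
          proof (intro order_trans[OF norm_sum] sum_mono)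
            fix k
            have "cmod (pd_partial k (F n) x - p k x) \<le> e / CARD('n)"
              using elim x by (auto simp: dist_norm less_imp_le)
            then show "cmod ((pd_partial k (F n) x - p k x) * h $ k) \<le> e / CARD('n) * norm h"
              unfolding norm_mult using e by (intro mult_mono Finite_Cartesian_Product.norm_nth_le) auto
          qed
          finally show "norm (?F' n x h - ?g' x h) \<le> e * norm h" by simp
        qed
      qed
    qed
    show z: "z \<in> closed_pd r" using r(3) interior_subset by blast
    show "(\<lambda>n. F n z) \<longlonglongrightarrow> g z" by (rule tendsto_uniform_limitI[OF lim[OF r(2)] z])
  qed (rule convex_closed_pd)
  then obtain g0 where g0: "\<And>x. x \<in> closed_pd r \<Longrightarrow> (\<lambda>n. F n x) \<longlonglongrightarrow> g0 x"
    "\<And>x. x \<in> closed_pd r \<Longrightarrow> (g0 has_derivative ?g' x) (at x within closed_pd r)" by blast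
  \<comment> \<open>The differentiable limit \<open>g0\<close> comes from an existence statement;
    uniqueness of limits identifies it with \<open>g\<close>.\<close>
  have eq: "g0 x = g x" if "x \<in> closed_pd r" for x
    by (rule LIMSEQ_unique[OF g0(1)[OF that] tendsto_uniform_limitI[OF lim[OF r(2)] that]])
  have "z \<in> closed_pd r" using r(3) interior_subset by blast
  then have "(g has_derivative ?g' z) (at z within closed_pd r)"
    using eq g0(2) by (metis (no_types, lifting) has_derivative_transform)
  then have "(g has_derivative ?g' z) (at z)"
    using at_within_interior[OF r(3)] by simp
  then show "\<exists>a::complex^'n. (g has_derivative (\<lambda>h. \<Sum>j\<in>UNIV. a $ j * h $ j)) (at z)"
    by (intro exI[of _ "\<chi> k. p k z"]) simp
qed

section \<open>Uniform boundedness and equicontinuity on closed polydisks\<close>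

lemma ln_cayley_mono:
  fixes a b :: real
  assumes "0 \<le> a" "a \<le> b" "b < 1"
  shows "ln ((1 + a) / (1 - a)) \<le> ln ((1 + b) / (1 - b))"
proof -
  have "(1 + a) / (1 - a) \<le> (1 + b) / (1 - b)" using assms by (intro frac_le) auto
  then show ?thesis using assms by (subst ln_le_cancel_iff) auto
qed

lemma ln_cayley_nonneg: "0 \<le> a \<Longrightarrow> a < 1 \<Longrightarrow> 0 \<le> ln ((1 + a) / (1 - a :: real))"
  using ln_cayley_mono[of 0 a] by simp

lemma bloch_log_le:
  fixes z :: "complex^'n::finite"
  assumes "z \<in> closed_pd r" "r < 1"
  shows "bloch_log z \<le> CARD('n) * ln ((1 + r) / (1 - r)) / 2"
proof -
  have "(\<Sum>j\<in>UNIV. ln ((1 + cmod (z $ j)) / (1 - cmod (z $ j)))) \<le> (\<Sum>j\<in>(UNIV::'n set). ln ((1 + r) / (1 - r)))"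
    using assms by (intro sum_mono ln_cayley_mono) (auto simp: closed_pd_def)
  then show ?thesis by (simp add: bloch_log_def)
qed

lemma bloch_log_nonneg: "z \<in> polydisk \<Longrightarrow> 0 \<le> bloch_log z"
  unfolding bloch_log_def polydisk_def
  by (intro divide_nonneg_nonneg sum_nonneg ln_cayley_nonneg) auto

text \<open>On \<open>closed_pd r\<close> the Bergman weights are at most
  \<open>1 / (1 - r\<^sup>2)\<close>, which bounds the derivative. The constant depends on
  \<open>f\<close> only through its norm, so the unit ball is equicontinuous there.\<close>

lemma bloch_lipschitz:
  fixes f :: "complex^'n::finite \<Rightarrow> complex"
  assumes f: "f \<in> bloch_space" and r: "r < 1" and xy: "x \<in> closed_pd r" "y \<in> closed_pd r"
  shows "cmod (f x - f y) \<le> bloch_norm f * (CARD('n) / (1 - r\<^sup>2)) * norm (x - y)"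
proof (rule differentiable_bound[OF convex_closed_pd _ _ xy])
  fix z :: "complex^'n" assume z: "z \<in> closed_pd r"
  then have zp: "z \<in> polydisk" using closed_pd_subset[OF r] by blast
  then show "(f has_derivative (\<lambda>h. \<Sum>k\<in>UNIV. pd_partial k f z * h $ k)) (at z within closed_pd r)"
    using f by (intro has_derivative_at_withinI[OF holo_pd_has_derivative]) (auto simp: bloch_space_def)
  have n0: "0 \<le> bloch_norm f"
    using cmod_0_le_bloch_norm[OF f] norm_ge_zero order_trans by blast
  have "cmod (\<Sum>k\<in>UNIV. pd_partial k f z * h $ k) \<le> bloch_norm f * (CARD('n) / (1 - r\<^sup>2)) * norm h" for h
  proof -
    have "cmod (h $ j) / (1 - (cmod (z $ j))\<^sup>2) \<le> norm h / (1 - r\<^sup>2)" for j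
    proof (rule frac_le)
      have zr: "cmod (z $ j) \<le> r" using z by (simp add: closed_pd_def)
      then have r0: "0 \<le> r" using norm_ge_zero order_trans by blast
      then show "0 < 1 - r\<^sup>2" using r by (simp add: abs_square_less_1)
      show "1 - r\<^sup>2 \<le> 1 - (cmod (z $ j))\<^sup>2" using zr by (simp add: power_mono)
    qed (auto simp: Finite_Cartesian_Product.norm_nth_le)
    then have "(\<Sum>j\<in>UNIV. cmod (h $ j) / (1 - (cmod (z $ j))\<^sup>2)) \<le> (\<Sum>j\<in>(UNIV::'n set). norm h / (1 - r\<^sup>2))"
      by (intro sum_mono)
    then have "bloch_norm f * (\<Sum>j\<in>UNIV. cmod (h $ j) / (1 - (cmod (z $ j))\<^sup>2)) \<le> 
        bloch_norm f * (CARD('n) * (norm h / (1 - r\<^sup>2)))"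
      using n0 by (intro mult_left_mono) auto
    with bloch_partial_bound[OF f zp, of h] show ?thesis by simp
  qed
  then show "onorm (\<lambda>h. \<Sum>k\<in>UNIV. pd_partial k f z * h $ k) \<le> bloch_norm f * (CARD('n) / (1 - r\<^sup>2))"
    by (rule onorm_le)
qed

text \<open>The growth and Lipschitz bounds allow Arzela-Ascoli on each member of a countable
  exhaustion; a diagonal sequence then serves all radii at once.\<close>

lemma bloch_ball_normal:
  fixes s :: "nat \<Rightarrow> complex^'n::finite \<Rightarrow> complex"
  assumes s: "\<And>m. s m \<in> bloch_space" "\<And>m. bloch_norm (s m) \<le> 1"
  obtains k g where "strict_mono (k :: nat \<Rightarrow> nat)" "holo_pd g"
    "\<And>r. r < 1 \<Longrightarrow> uniform_limit (closed_pd r) (\<lambda>m. s (k m)) g sequentially"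
proof -
  \<comment> \<open>Radii increasing to 1 from 1/2.\<close>
  define R where "R i = 1 - 1 / (real i + 2)" for i
  have R: "0 < R i" "R i < 1" for i by (auto simp: R_def)
  \<comment> \<open>The Cauchy property names no limit function and depends on tails only, as the
    diagonal argument requires.\<close>
  let ?P = "\<lambda>i (k::nat \<Rightarrow> nat). uniformly_Cauchy_on (closed_pd (R i)) (\<lambda>m. s (k m))"
  obtain k where k: "strict_mono (k::nat\<Rightarrow>nat)" "\<And>i. ?P i (id \<circ> k)"
  proof (rule subsequence_diagonalization_lemma[of ?P id])
    fix i and q :: "nat \<Rightarrow> nat"
    let ?C = "CARD('n) / (1 - (R i)\<^sup>2)"
    have C: "0 < ?C" using R[of i] by (simp add: abs_square_less_1)
    obtain g k where k: "strict_mono (k::nat\<Rightarrow>nat)" and g: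
      "\<And>e. 0 < e \<Longrightarrow> \<exists>N. \<forall>n x. n \<ge> N \<and> x \<in> closed_pd (R i) \<longrightarrow> norm (s (q (k n)) x - g x) < e"
    proof (rule Arzela_Ascoli[of "closed_pd (R i)" "\<lambda>n. s (q n)" "1 + CARD('n) * ln ((1 + R i) / (1 - R i)) / 2"])
      show "norm (s (q n) x) \<le> 1 + CARD('n) * ln ((1 + R i) / (1 - R i)) / 2" if x: "x \<in> closed_pd (R i)" for n x
      proof -
        have xp: "x \<in> polydisk" using x closed_pd_subset[OF R(2)] by blast
        have "bloch_norm (s (q n)) * (1 + bloch_log x) \<le> 1 * (1 + bloch_log x)"
          using s(2) bloch_log_nonneg[OF xp] by (intro mult_right_mono) auto
        with bloch_growth[OF s(1) xp, of "q n"] bloch_log_le[OF x R(2)] show ?thesis by simp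
      qed
      show "\<exists>d>0. \<forall>n y. y \<in> closed_pd (R i) \<and> norm (x - y) < d \<longrightarrow> norm (s (q n) x - s (q n) y) < e"
        if x: "x \<in> closed_pd (R i)" and e: "0 < e" for x and e :: real
      proof (intro exI[of _ "e / ?C"] conjI allI impI)
        show "0 < e / ?C" using e C by (rule divide_pos_pos)
        fix n y assume y: "y \<in> closed_pd (R i) \<and> norm (x - y) < e / ?C"
        have "norm (s (q n) x - s (q n) y) \<le> bloch_norm (s (q n)) * ?C * norm (x - y)"
          using y by (intro bloch_lipschitz s x R) auto
        also have "\<dots> \<le> 1 * ?C * norm (x - y)"
          using s(2) C by (intro mult_right_mono) auto
        also have "\<dots> < e" using y by (simp only: pos_less_divide_eq[OF C] mult_1 mult.commute)
        finally show "norm (s (q n) x - s (q n) y) < e" .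
      qed
    qed (auto simp: compact_closed_pd)
    have "uniform_limit (closed_pd (R i)) (\<lambda>n. s (q (k n))) g sequentially"
      unfolding uniform_limit_sequentially_iff dist_norm using g by meson
    then have "?P i (q \<circ> k)"
      using uniformly_convergent_Cauchy uniformly_convergent_on_def by fastforce
    then show "\<exists>k. strict_mono k \<and> ?P i (q \<circ> k)" using k by blast
  next
    \<comment> \<open>The property passes to a sequence that, from index \<open>N\<close> on, takes
      its terms from \<open>k1\<close> at the same or later positions.\<close>
    fix i N and q k1 k2 :: "nat \<Rightarrow> nat"
    assume P: "?P i (q \<circ> k1)" and sub: "\<And>j. N \<le> j \<Longrightarrow> \<exists>j'\<ge>j. k2 j = k1 j'"
    show "?P i (q \<circ> k2)" unfolding uniformly_Cauchy_on_def
    proof (intro allI impI)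
      fix e :: real assume "0 < e"
      then obtain M where M: "\<forall>x\<in>closed_pd (R i). \<forall>m\<ge>M. \<forall>n\<ge>M. dist (s ((q \<circ> k1) m) x) (s ((q \<circ> k1) n) x) < e"
        using P unfolding uniformly_Cauchy_on_def by meson
      have "dist (s ((q \<circ> k2) m) x) (s ((q \<circ> k2) n) x) < e"
        if x: "x \<in> closed_pd (R i)" and mn: "m \<ge> max M N" "n \<ge> max M N" for x m n
      proof -
        obtain m' where m': "m' \<ge> m" "k2 m = k1 m'" using sub[of m] mn by auto
        obtain n' where n': "n' \<ge> n" "k2 n = k1 n'" using sub[of n] mn by auto
        have "M \<le> m'" "M \<le> n'" using m' n' mn by auto
        then show ?thesis using M x m'(2) n'(2) by (simp add: o_def)
      qed
      then show "\<exists>M. \<forall>x\<in>closed_pd (R i). \<forall>m\<ge>M. \<forall>n\<ge>M. dist (s ((q \<circ> k2) m) x) (s ((q \<circ> k2) n) x) < e"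
        by (intro exI[of _ "max M N"]) simp
    qed
  next
    fix k :: "nat \<Rightarrow> nat" assume "strict_mono k" "\<And>i. ?P i (id \<circ> k)"
    then show thesis by (rule that)
  qed
  \<comment> \<open>Being a pointwise limit, \<open>g\<close> agrees with the uniform limit on every
    closed polydisk, so one function serves all radii.\<close>
  define g where "g x = lim (\<lambda>m. s (k m) x)" for x
  have lim: "uniform_limit (closed_pd r) (\<lambda>m. s (k m)) g sequentially" if "r < 1" for r
  proof -
    obtain i :: nat where "1 / (1 - r) \<le> real i" using real_arch_simple by blast
    then have "1 / (real i + 2) \<le> 1 - r" using that by (simp add: field_simps)
    then have ri: "r \<le> R i" by (simp add: R_def)
    obtain l where l: "uniform_limit (closed_pd (R i)) (\<lambda>m. s (k m)) l sequentially"
      using k(2)[of i] Cauchy_uniformly_convergent[of "closed_pd (R i)" "\<lambda>m. s (k m)"]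
      unfolding uniformly_convergent_on_def by auto
    have "l x = g x" if "x \<in> closed_pd (R i)" for x
      using tendsto_uniform_limitI[OF l that] by (simp add: g_def limI)
    then have "uniform_limit (closed_pd (R i)) (\<lambda>m. s (k m)) g sequentially"
      using l uniform_limit_cong'[of "closed_pd (R i)" "\<lambda>m. s (k m)" "\<lambda>m. s (k m)" l g sequentially] by simp
    then show ?thesis by (rule uniform_limit_on_subset[OF _ closed_pd_mono[OF ri]])
  qed
  have "holo_pd (s (k m))" for m
    using s(1) by (simp add: bloch_space_def)
  then have "holo_pd g" using lim by (rule holo_pd_uniform_limit)
  with k(1) show thesis using lim by (rule that)
qed

section \<open>Weighted composition operators\<close>

text \<open>One coordinate of modulus above 9/10 contributes at least \<open>ln 19 / 2\<close>, and
  \<open>exp 2 \<le> 9 < 19\<close>. This lets the 1 in the growth factor be absorbed near the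
  boundary.\<close>

lemma bloch_log_ge_1:
  assumes z: "z \<in> polydisk" "z \<notin> closed_pd (9/10)"
  shows "1 \<le> bloch_log z"
proof -
  obtain j where j: "9/10 < cmod (z $ j)" using z(2) by (auto simp: closed_pd_def not_le)
  have z1: "cmod (z $ i) < 1" for i using z by (simp add: polydisk_def)
  have "exp (2::real) = exp 1 * exp 1" by (simp flip: exp_add)
  also have "\<dots> \<le> 3 * (3::real)" by (intro mult_mono exp_le) auto
  finally have "2 \<le> ln (19::real)" by (subst ln_ge_iff) auto
  also have "\<dots> \<le> ln ((1 + cmod (z $ j)) / (1 - cmod (z $ j)))"
    using ln_cayley_mono[of "9/10" "cmod (z $ j)"] j z1 by simp
  also have "\<dots> \<le> (\<Sum>j\<in>UNIV. ln ((1 + cmod (z $ j)) / (1 - cmod (z $ j))))"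
    by (rule member_le_sum) (auto intro: ln_cayley_nonneg z1)
  finally show ?thesis by (simp add: bloch_log_def)
qed

lemma Hinf_norm_upper:
  "f \<in> Hinf mu \<Longrightarrow> z \<in> polydisk \<Longrightarrow> mu z * cmod (f z) \<le> Hinf_norm mu f"
  unfolding Hinf_norm_def Hinf_def by (intro cSUP_upper) auto

lemma Hinf_diff:
  assumes "is_weight mu" "f \<in> Hinf mu" "g \<in> Hinf mu"
  shows "(\<lambda>z. f z - g z) \<in> Hinf mu"
proof -
  have "mu z * cmod (f z - g z) \<le> Hinf_norm mu f + Hinf_norm mu g" if z: "z \<in> polydisk" for z
  proof -
    have "mu z * cmod (f z - g z) \<le> mu z * (cmod (f z) + cmod (g z))"
      using assms z by (intro mult_left_mono norm_triangle_ineq4) (auto simp: is_weight_def less_imp_le)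
    with Hinf_norm_upper[OF assms(2) z] Hinf_norm_upper[OF assms(3) z] show ?thesis
      by (simp add: distrib_left)
  qed
  moreover have "holo_pd (\<lambda>z. f z - g z)" using assms by (auto simp: Hinf_def intro: holo_pd_diff)
  ultimately show ?thesis by (auto simp: Hinf_def intro!: bdd_aboveI)
qed

text \<open>The limit condition in (c), with its factor 1/2 absorbed into \<open>bloch_log\<close>;
  membership of \<open>psi\<close> in \<open>Hinf mu\<close> is kept apart.\<close>

definition log_vanishing ::
  "(complex^'n::finite \<Rightarrow> real) \<Rightarrow> (complex^'n \<Rightarrow> complex) \<Rightarrow> (complex^'n \<Rightarrow> complex^'n) \<Rightarrow> bool" where
  "log_vanishing mu psi phi \<longleftrightarrow> (\<forall>s::nat \<Rightarrow> complex^'n. (\<forall>k. s k \<in> polydisk) \<and>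
      (\<lambda>k. Max (range (\<lambda>j. cmod (phi (s k) $ j)))) \<longlonglongrightarrow> 1 \<longrightarrow>
      (\<lambda>k. mu (s k) * cmod (psi (s k)) * bloch_log (phi (s k))) \<longlonglongrightarrow> 0)"

text \<open>Passage from the sequential limit to a uniform one: if every radius failed, bad points
  for radii tending to 1 would form a sequence contradicting the hypothesis.\<close>

lemma log_vanishing_uniform:
  fixes phi :: "complex^'n::finite \<Rightarrow> complex^'n"
  assumes v: "log_vanishing mu psi phi" and phi: "holo_selfmap phi" and e: "0 < e"
  obtains r where "9/10 \<le> r" "r < 1" "\<And>z. z \<in> polydisk \<Longrightarrow> phi z \<notin> closed_pd r \<Longrightarrow>
    mu z * cmod (psi z) * bloch_log (phi z) < e"
proof (rule ccontr)
  assume neg: "\<not> thesis"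
  \<comment> \<open>The shift by 10 makes the radii start at exactly 9/10.\<close>
  define R where "R n = 1 - 1 / (real n + 10)" for n
  have R: "9/10 \<le> R n" "R n < 1" for n by (auto simp: R_def field_simps)
  have "\<exists>z. z \<in> polydisk \<and> phi z \<notin> closed_pd (R n) \<and> e \<le> mu z * cmod (psi z) * bloch_log (phi z)" for n
    using neg that[OF R[of n]] by (meson not_le)
  then obtain s where s: "\<And>n. s n \<in> polydisk" "\<And>n. phi (s n) \<notin> closed_pd (R n)"
    "\<And>n. e \<le> mu (s n) * cmod (psi (s n)) * bloch_log (phi (s n))" by metis
  have "(\<lambda>n. Max (range (\<lambda>j. cmod (phi (s n) $ j)))) \<longlonglongrightarrow> 1"
  proof (rule tendsto_sandwich)
    show "R \<longlonglongrightarrow> 1" unfolding R_def by real_asymp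
    show "\<forall>\<^sub>F n in sequentially. R n \<le> Max (range (\<lambda>j. cmod (phi (s n) $ j)))"
    proof (intro always_eventually allI)
      fix n
      obtain j where "R n < cmod (phi (s n) $ j)" using s(2)[of n] by (auto simp: closed_pd_def not_le)
      also have "\<dots> \<le> Max (range (\<lambda>j. cmod (phi (s n) $ j)))" by simp
      finally show "R n \<le> Max (range (\<lambda>j. cmod (phi (s n) $ j)))" by simp
    qed
    show "\<forall>\<^sub>F n in sequentially. Max (range (\<lambda>j. cmod (phi (s n) $ j))) \<le> 1"
    proof (intro always_eventually allI)
      fix n
      have "phi (s n) \<in> polydisk" using phi s(1) by (auto simp: holo_selfmap_def)
      then show "Max (range (\<lambda>j. cmod (phi (s n) $ j))) \<le> 1" by (auto simp: polydisk_def less_imp_le)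
    qed
  qed auto
  then have "(\<lambda>n. mu (s n) * cmod (psi (s n)) * bloch_log (phi (s n))) \<longlonglongrightarrow> 0"
    using v s(1) unfolding log_vanishing_def by blast
  then have "e \<le> 0" using s(3) by (intro LIMSEQ_le_const[where x = 0 and a = e]) auto
  with e show False by simp
qed

text \<open>Off \<open>closed_pd (9/10)\<close> the weight \<open>1 + bloch_log\<close> is at most twice \<open>bloch_log\<close>, so the
  vanishing condition also controls \<open>psi\<close> itself near the boundary.\<close>

lemma log_vanishing_uniform_growth:
  fixes phi :: "complex^'n::finite \<Rightarrow> complex^'n"
  assumes mu: "is_weight mu" and v: "log_vanishing mu psi phi" and phi: "holo_selfmap phi" and e: "0 < e"
  obtains r where "9/10 \<le> r" "r < 1" "\<And>z. z \<in> polydisk \<Longrightarrow> phi z \<notin> closed_pd r \<Longrightarrow>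
    mu z * cmod (psi z) * (1 + bloch_log (phi z)) \<le> e"
proof -
  have "0 < e / 2" using e by simp
  then obtain r where r: "9/10 \<le> r" "r < 1" "\<And>z. z \<in> polydisk \<Longrightarrow> phi z \<notin> closed_pd r \<Longrightarrow>
    mu z * cmod (psi z) * bloch_log (phi z) < e / 2"
    using log_vanishing_uniform[OF v phi] by metis
  have "mu z * cmod (psi z) * (1 + bloch_log (phi z)) \<le> e" if z: "z \<in> polydisk" "phi z \<notin> closed_pd r" for z
  proof -
    have "1 \<le> bloch_log (phi z)"
      using z phi closed_pd_mono[OF r(1)] by (intro bloch_log_ge_1) (auto simp: holo_selfmap_def)
    then have "mu z * cmod (psi z) * (1 + bloch_log (phi z)) \<le> mu z * cmod (psi z) * (2 * bloch_log (phi z))"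
      using mu z by (intro mult_left_mono) (auto simp: is_weight_def less_imp_le)
    with r(3)[OF z] show ?thesis by simp
  qed
  with r that show thesis by blast
qed

text \<open>The hypothesis on \<open>f\<close> is its growth alone, so the lemma covers limits of
  Bloch functions as well as Bloch functions themselves.\<close>

lemma wcomp_in_Hinf:
  fixes phi :: "complex^'n::finite \<Rightarrow> complex^'n"
  assumes mu: "is_weight mu" and psi: "psi \<in> Hinf mu" and phi: "holo_selfmap phi"
    and v: "log_vanishing mu psi phi"
    and f: "holo_pd f" "\<And>w. w \<in> polydisk \<Longrightarrow> cmod (f w) \<le> C * (1 + bloch_log w)"
  shows "wcomp psi phi f \<in> Hinf mu"
proof -
  obtain r where r: "9/10 \<le> r" "r < 1" "\<And>z. z \<in> polydisk \<Longrightarrow> phi z \<notin> closed_pd r \<Longrightarrow>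
    mu z * cmod (psi z) * (1 + bloch_log (phi z)) \<le> 1"
    by (rule log_vanishing_uniform_growth[OF mu v phi, of 1]) auto
  let ?B = "1 + CARD('n) * ln ((1 + r) / (1 - r)) / 2"
  \<comment> \<open>The first entry bounds the weighted growth factor where \<open>phi z\<close> is
    near the boundary, the second where it lies in \<open>closed_pd r\<close>.\<close>
  let ?M = "max 1 (Hinf_norm mu psi * ?B)"
  have B: "0 \<le> ?B" using ln_cayley_nonneg[of r] r by simp
  have "mu z * cmod (wcomp psi phi f z) \<le> \<bar>C\<bar> * ?M" if z: "z \<in> polydisk" for z
  proof -
    have pz: "phi z \<in> polydisk" using phi z by (auto simp: holo_selfmap_def)
    have A: "0 \<le> mu z * cmod (psi z)" using mu z by (auto simp: is_weight_def less_imp_le)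
    have l: "0 \<le> bloch_log (phi z)" by (rule bloch_log_nonneg[OF pz])
    have "mu z * cmod (psi z) * (1 + bloch_log (phi z)) \<le> ?M"
    proof (cases "phi z \<in> closed_pd r")
      case True
      have "mu z * cmod (psi z) * (1 + bloch_log (phi z)) \<le> Hinf_norm mu psi * ?B"
        using bloch_log_le[OF True r(2)] Hinf_norm_upper[OF psi z] l A by (intro mult_mono) auto
      then show ?thesis by simp
    qed (use r(3)[OF z] in auto)
    then have le: "\<bar>C\<bar> * (mu z * cmod (psi z) * (1 + bloch_log (phi z))) \<le> \<bar>C\<bar> * ?M"
      by (rule mult_left_mono) simp
    have fC: "cmod (f (phi z)) \<le> \<bar>C\<bar> * (1 + bloch_log (phi z))"
      using f(2)[OF pz] l by (intro order_trans[OF _ mult_right_mono[of C "\<bar>C\<bar>"]]) auto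
    have "mu z * cmod (wcomp psi phi f z) = mu z * cmod (psi z) * cmod (f (phi z))"
      by (simp add: wcomp_def norm_mult)
    also have "\<dots> \<le> mu z * cmod (psi z) * (\<bar>C\<bar> * (1 + bloch_log (phi z)))"
      by (rule mult_left_mono[OF fC A])
    also have "\<dots> = \<bar>C\<bar> * (mu z * cmod (psi z) * (1 + bloch_log (phi z)))"
      by (rule mult.left_commute)
    finally show ?thesis using le by (rule order_trans)
  qed
  then have "bdd_above ((\<lambda>z. mu z * cmod (wcomp psi phi f z)) ` polydisk)"
    by (rule bdd_aboveI2)
  moreover have "holo_pd psi" using psi by (simp add: Hinf_def)
  then have "holo_pd (wcomp psi phi f)"
    unfolding wcomp_def by (rule holo_pd_mult[OF _ holo_pd_compose[OF f(1) phi]])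
  ultimately show ?thesis by (simp add: Hinf_def)
qed

section \<open>Sufficiency of the vanishing condition\<close>

lemma Hinf_norm_nonneg:
  assumes "is_weight mu" "f \<in> Hinf mu"
  shows "0 \<le> Hinf_norm mu f"
proof -
  have "0 \<le> mu 0 * cmod (f 0)" using assms(1) by (auto simp: is_weight_def less_imp_le)
  with Hinf_norm_upper[OF assms(2), of 0] show ?thesis by simp
qed

lemma compact_op_bloch_if_log_vanishing:
  fixes phi :: "complex^'n::finite \<Rightarrow> complex^'n"
  assumes mu: "is_weight mu" and psi: "psi \<in> Hinf mu" and phi: "holo_selfmap phi"
    and v: "log_vanishing mu psi phi"
  shows "compact_op bloch_space bloch_norm (Hinf mu) (Hinf_norm mu) (wcomp psi phi)"
  unfolding compact_op_def
proof (intro conjI ballI allI impI)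
  fix f :: "complex^'n \<Rightarrow> complex" assume f: "f \<in> bloch_space"
  then show "wcomp psi phi f \<in> Hinf mu"
    using bloch_growth[OF f] by (intro wcomp_in_Hinf[OF mu psi phi v]) (auto simp: bloch_space_def)
next
  fix s :: "nat \<Rightarrow> complex^'n \<Rightarrow> complex"
  assume "\<forall>m. s m \<in> bloch_space \<and> bloch_norm (s m) \<le> 1"
  then have s: "\<And>m. s m \<in> bloch_space" "\<And>m. bloch_norm (s m) \<le> 1" by auto
  obtain k g where k: "strict_mono (k :: nat \<Rightarrow> nat)" and g: "holo_pd g"
    and lim: "\<And>r. r < 1 \<Longrightarrow> uniform_limit (closed_pd r) (\<lambda>m. s (k m)) g sequentially"
    using bloch_ball_normal[of s, OF s] by blast
  have sb: "cmod (s m w) \<le> 1 * (1 + bloch_log w)" if w: "w \<in> polydisk" for m w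
    using bloch_log_nonneg[OF w]
    by (intro order_trans[OF bloch_growth[OF s(1) w] mult_right_mono] s(2)) simp
  \<comment> \<open>The growth bound survives pointwise limits; this alone puts
    \<open>wcomp psi phi g\<close> into \<open>Hinf mu\<close>.\<close>
  have gb: "cmod (g w) \<le> 1 * (1 + bloch_log w)" if w: "w \<in> polydisk" for w
  proof -
    obtain r where r: "r < 1" "w \<in> interior (closed_pd r)"
      using polydisk_interior_closed_pd[OF w] by metis
    then have "(\<lambda>m. s (k m) w) \<longlonglongrightarrow> g w"
      using interior_subset by (intro tendsto_uniform_limitI[OF lim]) auto
    then show ?thesis
      using sb[OF w] by (intro LIMSEQ_le_const2[OF tendsto_norm]) auto
  qed
  have T: "wcomp psi phi g \<in> Hinf mu" "wcomp psi phi (s m) \<in> Hinf mu" for m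
    using s(1) by (auto intro!: wcomp_in_Hinf[OF mu psi phi v _ gb] wcomp_in_Hinf[OF mu psi phi v _ sb] g
        simp: bloch_space_def)
  let ?h = "\<lambda>m z. wcomp psi phi (s (k m)) z - wcomp psi phi g z"
  have hH: "?h m \<in> Hinf mu" for m by (intro Hinf_diff mu T)
  have "(\<lambda>m. Hinf_norm mu (?h m)) \<longlonglongrightarrow> 0"
  proof (rule tendstoI)
    fix e :: real assume e: "0 < e"
    \<comment> \<open>A difference of two functions of growth \<open>1 + bloch_log\<close> costs a
      factor 2, so \<open>e / 4\<close> leads to \<open>e / 2\<close>, which is strictly below
      \<open>e\<close>.\<close>
    then have "0 < e / 4" by simp
    then obtain r where r: "9/10 \<le> r" "r < 1" "\<And>z. z \<in> polydisk \<Longrightarrow> phi z \<notin> closed_pd r \<Longrightarrow>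
        mu z * cmod (psi z) * (1 + bloch_log (phi z)) \<le> e / 4"
      using log_vanishing_uniform_growth[OF mu v phi] by metis
    \<comment> \<open>The added 1 makes \<open>M\<close> positive, so that it can be divided
      by.\<close>
    define M where "M = Hinf_norm mu psi + 1"
    have M: "0 < M" using Hinf_norm_nonneg[OF mu psi] by (simp add: M_def)
    have "0 < e / 2 / M" using e M by simp
    then have "\<forall>\<^sub>F m in sequentially. \<forall>x\<in>closed_pd r. dist (s (k m) x) (g x) < e / 2 / M"
      using lim[OF r(2)] unfolding uniform_limit_iff by blast
    then show "\<forall>\<^sub>F m in sequentially. dist (Hinf_norm mu (?h m)) 0 < e"
    proof eventually_elim
      case (elim m)
      have "Hinf_norm mu (?h m) \<le> e / 2" unfolding Hinf_norm_def
      proof (rule cSUP_least)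
        show "polydisk \<noteq> ({}::(complex^'n) set)" using zero_in_polydisk by blast
        fix z :: "complex^'n" assume z: "z \<in> polydisk"
        have pz: "phi z \<in> polydisk" using phi z by (auto simp: holo_selfmap_def)
        have A: "0 \<le> mu z * cmod (psi z)" using mu z by (auto simp: is_weight_def less_imp_le)
        have eq: "mu z * cmod (?h m z) = mu z * cmod (psi z) * cmod (s (k m) (phi z) - g (phi z))"
          by (simp add: wcomp_def norm_mult flip: right_diff_distrib)
        show "mu z * cmod (?h m z) \<le> e / 2"
        proof (cases "phi z \<in> closed_pd r")
          case True
          have "mu z * cmod (psi z) * cmod (s (k m) (phi z) - g (phi z)) \<le> M * (e / 2 / M)"
            using Hinf_norm_upper[OF psi z] elim True A M
            by (intro mult_mono) (auto simp: M_def dist_norm less_imp_le)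
          then show ?thesis unfolding eq using M by simp
        next
          case False
          have "cmod (s (k m) (phi z) - g (phi z)) \<le> 2 * (1 + bloch_log (phi z))"
            using norm_triangle_ineq4[of "s (k m) (phi z)" "g (phi z)"] sb[OF pz, of "k m"] gb[OF pz] by simp
          then have "mu z * cmod (psi z) * cmod (s (k m) (phi z) - g (phi z)) \<le>
              mu z * cmod (psi z) * (2 * (1 + bloch_log (phi z)))"
            using A by (intro mult_left_mono)
          also have "\<dots> = 2 * (mu z * cmod (psi z) * (1 + bloch_log (phi z)))"
            by (rule mult.left_commute)
          finally show ?thesis unfolding eq using r(3)[OF z False] by linarith
        qed
      qed
      with Hinf_norm_nonneg[OF mu hH, of m] e show ?case by simp
    qed
  qed
  then show "\<exists>(r::nat \<Rightarrow> nat) g. strict_mono r \<and> g \<in> Hinf mu \<and>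
      (\<lambda>m. Hinf_norm mu (\<lambda>z. wcomp psi phi (s (r m)) z - g z)) \<longlonglongrightarrow> 0"
    using k T(1) by blast
qed

section \<open>Logarithmic test functions\<close>

text \<open>The factor 28 makes the Bloch norm at most 1 as soon as \<open>- ln (1 - |w|\<^sup>2) \<ge> 1\<close>.\<close>

definition log_test :: "complex \<Rightarrow> complex \<Rightarrow> complex" where
  "log_test w x = (Ln (1 - cnj w * x))\<^sup>2 / of_real (28 * - ln (1 - (cmod w)\<^sup>2))"

text \<open>The constant 5 is 4, a bound for pi and so for the imaginary part, plus 1, a bound for
  \<open>ln 2\<close> in the real part.\<close>

lemma cmod_Ln_le:
  assumes "0 < q" "q \<le> 1" "q \<le> cmod u" "cmod u \<le> 2"
  shows "cmod (Ln u) \<le> 5 - ln q"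
proof -
  have u: "u \<noteq> 0" using assms by auto
  have "\<bar>Im (Ln u)\<bar> \<le> pi" using mpi_less_Im_Ln[OF u] Im_Ln_le_pi[OF u] by simp
  then have "\<bar>Im (Ln u)\<bar> \<le> 4" using pi_less_4 by simp
  moreover have "\<bar>Re (Ln u)\<bar> \<le> 1 - ln q"
  proof -
    have "ln q \<le> ln (cmod u)" using assms by (subst ln_le_cancel_iff) auto
    moreover have "ln (cmod u) \<le> ln 2" using assms by (subst ln_le_cancel_iff) auto
    moreover have "ln 2 < (1::real)" by (rule ln_2_less_1)
    moreover have "ln q \<le> 0" using assms by simp
    ultimately show ?thesis unfolding Re_Ln[OF u] by linarith
  qed
  ultimately show ?thesis using cmod_le[of "Ln u"] by simp
qed

context
  fixes w :: complex
  assumes w: "cmod w < 1" and w_large: "1 \<le> - ln (1 - (cmod w)\<^sup>2)"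
begin

private abbreviation L :: real where "L \<equiv> - ln (1 - (cmod w)\<^sup>2)"

text \<open>All parts follow from \<open>cmod (cnj w * x)\<close> being at most both
  \<open>cmod w\<close> and \<open>cmod x\<close>. The first lower bound is uniform in
  \<open>x\<close> and the second in \<open>w\<close>; the last part avoids the branch cut of
  \<open>Ln\<close>.\<close>

lemma cmod_one_minus_bounds:
  assumes "cmod x < 1"
  shows "1 - cmod w \<le> cmod (1 - cnj w * x)" "1 - cmod x \<le> cmod (1 - cnj w * x)"
    "cmod (1 - cnj w * x) \<le> 2" "1 - cnj w * x \<notin> \<real>\<^sub>\<le>\<^sub>0"
proof -
  have p: "cmod (cnj w * x) \<le> cmod w" "cmod (cnj w * x) \<le> cmod x"
    using w assms mult_left_le[of "cmod x" "cmod w"] mult_left_le_one_le[of "cmod x" "cmod w"]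
    by (auto simp: norm_mult)
  have "1 - cmod (cnj w * x) \<le> cmod (1 - cnj w * x)" using norm_triangle_ineq2[of 1 "cnj w * x"] by simp
  with p show "1 - cmod w \<le> cmod (1 - cnj w * x)" "1 - cmod x \<le> cmod (1 - cnj w * x)" by auto
  show "cmod (1 - cnj w * x) \<le> 2" using norm_triangle_ineq4[of 1 "cnj w * x"] p w by simp
  have "Re (cnj w * x) < 1" using p w complex_Re_le_cmod[of "cnj w * x"] by linarith
  then have "0 < Re (1 - cnj w * x)" by simp
  then show "1 - cnj w * x \<notin> \<real>\<^sub>\<le>\<^sub>0" by (auto simp: complex_nonpos_Reals_iff simp del: minus_complex.sel)
qed

definition log_test_deriv :: "complex \<Rightarrow> complex" where
  "log_test_deriv x = 2 * Ln (1 - cnj w * x) * (- cnj w / (1 - cnj w * x)) / of_real (28 * L)"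

lemma log_test_has_derivative:
  assumes "cmod x < 1"
  shows "(log_test w has_field_derivative log_test_deriv x) (at x)"
proof -
  have n: "1 - cnj w * x \<notin> \<real>\<^sub>\<le>\<^sub>0" by (rule cmod_one_minus_bounds(4)[OF assms])
  have "((\<lambda>x. Ln (1 - cnj w * x)) has_field_derivative (- cnj w / (1 - cnj w * x))) (at x)"
    using n by (auto intro!: derivative_eq_intros simp: field_simps)
  from DERIV_cdivide[OF DERIV_power[OF this, of 2], of "of_real (28 * L)"]
  show ?thesis unfolding log_test_def[abs_def] log_test_deriv_def
    by (simp add: mult.assoc)
qed

lemma log_test_deriv_le:
  assumes x: "cmod x < 1"
  shows "cmod (log_test_deriv x) \<le> 1 / (2 * cmod (1 - cnj w * x))"
proof -
  let ?u = "1 - cnj w * x"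
  have u: "0 < cmod ?u" using cmod_one_minus_bounds(1)[OF x] w by linarith
  have "(1 - cmod w) * 2 \<ge> (1 - cmod w) * (1 + cmod w)" using w by (intro mult_left_mono) auto
  then have "1 - (cmod w)\<^sup>2 \<le> 2 * (1 - cmod w)" by (simp add: power2_eq_square algebra_simps)
  moreover have "0 < 1 - (cmod w)\<^sup>2" using w by (simp add: abs_square_less_1)
  ultimately have "ln (1 - (cmod w)\<^sup>2) \<le> ln (2 * (1 - cmod w))" using w by (subst ln_le_cancel_iff) auto
  also have "\<dots> = ln 2 + ln (1 - cmod w)" using w by (intro ln_mult_pos) auto
  finally have "- ln (1 - cmod w) \<le> 1 + L" using ln_2_less_1 by linarith
  moreover have "cmod (Ln ?u) \<le> 5 - ln (1 - cmod w)"
    using cmod_one_minus_bounds[OF x] w by (intro cmod_Ln_le) auto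
  \<comment> \<open>The bounds add up to \<open>6 + L\<close>, and \<open>1 \<le> L\<close> absorbs
    the constant. The factors 2 and 7 against 28 then leave 1/2.\<close>
  ultimately have l: "cmod (Ln ?u) \<le> 7 * L" using w_large by linarith
  have "cmod (log_test_deriv x) = 2 * cmod (Ln ?u) * (cmod w / cmod ?u) / (28 * L)"
    using w_large by (simp add: log_test_deriv_def norm_mult norm_divide)
  also have "\<dots> \<le> 2 * (7 * L) * (1 / cmod ?u) / (28 * L)"
    using l w w_large u by (intro divide_right_mono mult_mono) auto
  also have "\<dots> = 1 / (2 * cmod ?u)" using w_large u by (simp add: field_simps)
  finally show ?thesis .
qed

text \<open>A function of one coordinate has a one-term differential, so only the weight of
  coordinate \<open>i\<close> enters. The free bound \<open>c\<close> serves both the norm estimate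
  and the decay at the torus.\<close>

lemma log_test_Q_f_le:
  assumes z: "z \<in> polydisk" and c: "(1 - (cmod (z $ i))\<^sup>2) / (2 * cmod (1 - cnj w * z $ i)) \<le> c"
  shows "Q_f (\<lambda>z. log_test w (z $ i)) z \<le> c"
proof (rule Q_f_le[OF z])
  fix u :: "complex^'a"
  have zi: "cmod (z $ i) < 1" using z by (simp add: polydisk_def)
  have d: "((\<lambda>z. log_test w (z $ i)) has_derivative
      (\<lambda>u. \<Sum>j\<in>UNIV. (\<chi> j. if j = i then log_test_deriv (z $ i) else 0) $ j * u $ j)) (at z)"
    using holo_pd_coord[OF log_test_has_derivative z, of i] by simp
  have "(\<Sum>k\<in>UNIV. pd_partial k (\<lambda>z. log_test w (z $ i)) z * u $ k) = log_test_deriv (z $ i) * u $ i"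
    by (simp add: pd_partial_eqI[OF d] if_distrib if_distribR cong: if_cong)
  then have "cmod (\<Sum>k\<in>UNIV. pd_partial k (\<lambda>z. log_test w (z $ i)) z * u $ k) =
      cmod (log_test_deriv (z $ i)) * cmod (u $ i)" by (simp add: norm_mult)
  also have "\<dots> \<le> 1 / (2 * cmod (1 - cnj w * z $ i)) * ((1 - (cmod (z $ i))\<^sup>2) * sqrt (bergman_H z u))"
    using log_test_deriv_le[OF zi] bergman_component'[OF z, of u i] by (intro mult_mono) auto
  also have "\<dots> = (1 - (cmod (z $ i))\<^sup>2) / (2 * cmod (1 - cnj w * z $ i)) * sqrt (bergman_H z u)" by simp
  also have "\<dots> \<le> c * sqrt (bergman_H z u)"
    using c by (intro mult_right_mono) (auto simp: bergman_H_def intro!: sum_nonneg)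
  finally show "cmod (\<Sum>k\<in>UNIV. pd_partial k (\<lambda>z. log_test w (z $ i)) z * u $ k) \<le> c * sqrt (bergman_H z u)" .
qed

lemma log_test_holo: "holo_pd (\<lambda>z. log_test w (z $ i))"
  by (rule holo_pdI[OF holo_pd_coord[OF log_test_has_derivative]])

text \<open>The numerator is at most \<open>2 * (1 - cmod (z $ i))\<close>, which the lower bound
  uniform in \<open>w\<close> compares with the denominator.\<close>

lemma log_test_Q_f_le_1:
  assumes z: "z \<in> polydisk"
  shows "Q_f (\<lambda>z. log_test w (z $ i)) z \<le> 1"
proof (rule log_test_Q_f_le[OF z])
  have zi: "cmod (z $ i) < 1" using z by (simp add: polydisk_def)
  have "1 - (cmod (z $ i))\<^sup>2 = (1 - cmod (z $ i)) * (1 + cmod (z $ i))"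
    by (simp add: power2_eq_square algebra_simps)
  also have "\<dots> \<le> cmod (1 - cnj w * z $ i) * 2"
    using cmod_one_minus_bounds(2)[OF zi] zi by (intro mult_mono) auto
  finally show "(1 - (cmod (z $ i))\<^sup>2) / (2 * cmod (1 - cnj w * z $ i)) \<le> 1"
    using cmod_one_minus_bounds(1)[OF zi] w by (simp add: divide_le_eq)
qed

lemma log_test_bloch0star:
  "(\<lambda>z::complex^'n::finite. log_test w (z $ i)) \<in> bloch0star"
proof -
  let ?f = "\<lambda>z::complex^'n. log_test w (z $ i)"
  have "?f \<in> bloch_space"
    using log_test_Q_f_le_1 by (auto simp: bloch_space_def log_test_holo intro!: bdd_aboveI)
  moreover have "\<exists>\<delta>>0. \<forall>z\<in>polydisk. (\<forall>j. cmod (z $ j) > 1 - \<delta>) \<longrightarrow> Q_f ?f z < \<epsilon>" if e: "0 < \<epsilon>" for \<epsilon>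
  \<comment> \<open>For fixed \<open>w\<close> the denominator is at least
    \<open>2 * (1 - cmod w)\<close>, while the numerator is at most twice this radius; the quotient
    is thus at most \<open>\<epsilon> / 2\<close>.\<close>
  proof (intro exI[of _ "\<epsilon> * (1 - cmod w) / 2"] conjI ballI impI)
    show "0 < \<epsilon> * (1 - cmod w) / 2" using e w by simp
    fix z :: "complex^'n" assume z: "z \<in> polydisk" and zb: "\<forall>j. 1 - \<epsilon> * (1 - cmod w) / 2 < cmod (z $ j)"
    have zi: "cmod (z $ i) < 1" using z by (simp add: polydisk_def)
    have u: "1 - cmod w \<le> cmod (1 - cnj w * z $ i)" by (rule cmod_one_minus_bounds(1)[OF zi])
    have "1 - (cmod (z $ i))\<^sup>2 = (1 - cmod (z $ i)) * (1 + cmod (z $ i))"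
      by (simp add: power2_eq_square algebra_simps)
    also have "\<dots> \<le> (\<epsilon> * (1 - cmod w) / 2) * 2"
      using zb[rule_format, of i] zi by (intro mult_mono) auto
    also have "\<dots> \<le> \<epsilon> * cmod (1 - cnj w * z $ i)" using u e by simp
    finally have "(1 - (cmod (z $ i))\<^sup>2) / (2 * cmod (1 - cnj w * z $ i)) \<le> \<epsilon> / 2"
      using less_le_trans[OF _ u, of 0] w by (subst pos_divide_le_eq) auto
    then have "Q_f ?f z \<le> \<epsilon> / 2" by (rule log_test_Q_f_le[OF z])
    with e show "Q_f ?f z < \<epsilon>" by simp
  qed
  ultimately show ?thesis by (simp add: bloch0star_def)
qed

text \<open>The value at the origin vanishes because \<open>Ln 1 = 0\<close>.\<close>

lemma log_test_bloch_norm: "bloch_norm (\<lambda>z::complex^'n::finite. log_test w (z $ i)) \<le> 1"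
proof -
  have "(SUP z\<in>(polydisk::(complex^'n) set). Q_f (\<lambda>z. log_test w (z $ i)) z) \<le> 1"
    by (rule cSUP_least) (use zero_in_polydisk log_test_Q_f_le_1 in blast)+
  then show ?thesis by (simp add: bloch_norm_def log_test_def)
qed

text \<open>At \<open>x = w\<close> the logarithm is real and equals \<open>- L\<close>; its square
  divided by \<open>28 * L\<close> still grows like \<open>L\<close>.\<close>

lemma log_test_self: "cmod (log_test w w) = L / 28"
proof -
  have "0 < 1 - (cmod w)\<^sup>2" using w by (simp add: abs_square_less_1)
  moreover have "1 - cnj w * w = of_real (1 - (cmod w)\<^sup>2)"
    unfolding of_real_diff complex_norm_square by (simp add: mult.commute)
  ultimately have "Ln (1 - cnj w * w) = of_real (- L)" by (simp only: Ln_of_real) simp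
  then have "cmod (log_test w w) = L\<^sup>2 / (28 * L)"
    using w_large by (simp add: log_test_def norm_divide norm_power norm_mult)
  also have "\<dots> = L / 28" using w_large by (simp add: power2_eq_square)
  finally show ?thesis .
qed

text \<open>On a fixed disk the numerator is bounded independently of \<open>w\<close>, so the test
  functions tend to 0 there as \<open>L\<close> grows.\<close>

lemma log_test_le:
  assumes "cmod x \<le> r" "r < 1"
  shows "cmod (log_test w x) \<le> (5 - ln (1 - r))\<^sup>2 / (28 * L)"
proof -
  have x: "cmod x < 1" using assms by simp
  have r0: "0 \<le> r" using assms(1) norm_ge_zero order_trans by blast
  have "cmod (Ln (1 - cnj w * x)) \<le> 5 - ln (1 - r)"
    using cmod_one_minus_bounds[OF x] assms r0 by (intro cmod_Ln_le) auto
  then have "(cmod (Ln (1 - cnj w * x)))\<^sup>2 \<le> (5 - ln (1 - r))\<^sup>2" by (intro power_mono) auto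
  moreover have "cmod (log_test w x) = (cmod (Ln (1 - cnj w * x)))\<^sup>2 / (28 * L)"
    using w_large by (simp add: log_test_def norm_divide norm_power norm_mult)
  ultimately show ?thesis using w_large by (simp only:) (rule divide_right_mono, auto)
qed

text \<open>With \<open>a = cmod w\<close>, (1 + a) / (1 - a) = (1 + a)^2 / (1 - a^2) is at most 4 /
  (1 - a^2), so each logarithm is at most \<open>2 * ln 2 + L\<close>. It is applied to points whose
  coordinate of largest modulus is \<open>w\<close>.\<close>

lemma bloch_log_le_ln:
  fixes z :: "complex^'n::finite"
  assumes "z \<in> closed_pd (cmod w)"
  shows "bloch_log z \<le> 2 * CARD('n) * L"
proof -
  have w2: "0 < 1 - (cmod w)\<^sup>2" using w by (simp add: abs_square_less_1)
  have "(1 + cmod w) / (1 - cmod w) = (1 + cmod w)\<^sup>2 / (1 - (cmod w)\<^sup>2)"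
    using w w2 by (simp add: divide_simps) (simp add: power2_eq_square algebra_simps)
  also have "\<dots> \<le> 2\<^sup>2 / (1 - (cmod w)\<^sup>2)"
    using w w2 by (intro divide_right_mono power_mono) auto
  finally have "ln ((1 + cmod w) / (1 - cmod w)) \<le> ln (2\<^sup>2 / (1 - (cmod w)\<^sup>2))"
    using w w2 by (subst ln_le_cancel_iff) (auto intro!: divide_pos_pos add_pos_nonneg)
  also have "\<dots> = 2 * ln 2 + L" using w2 by (simp only: ln_div ln_realpow) simp
  also have "\<dots> \<le> 4 * L" using w_large ln_2_less_1 by linarith
  finally have "CARD('n) * ln ((1 + cmod w) / (1 - cmod w)) \<le> CARD('n) * (4 * L)"
    by (intro mult_left_mono) auto
  with bloch_log_le[OF assms w] show ?thesis by simp
qed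

end

section \<open>Necessity of the vanishing condition\<close>

text \<open>Needed for the constant 1, whose image under the operator is \<open>psi\<close>.\<close>

lemma const_bloch0star: "(\<lambda>_::complex^'n::finite. c) \<in> bloch0star"
proof -
  have p: "pd_partial k (\<lambda>_::complex^'n. c) z = 0" for k z
    by (simp add: pd_partial_def)
  have Q: "Q_f (\<lambda>_::complex^'n. c) z \<le> 0" if "z \<in> polydisk" for z
    by (rule Q_f_le[OF that]) (simp add: p)
  then show ?thesis
    by (auto simp: bloch0star_def bloch_space_def intro!: bdd_aboveI exI[of _ 1] intro: le_less_trans)
qed

text \<open>Since \<open>mu\<close> is positive, norm convergence forces pointwise convergence. The
  limit supplied by compactness is therefore 0 on the polydisk.\<close>

lemma compact_op_pointwise_null:
  assumes mu: "is_weight mu"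
    and comp: "compact_op X nX (Hinf mu) (Hinf_norm mu) T"
    and f: "\<And>m. f m \<in> X" "\<And>m. nX (f m) \<le> 1"
    and null: "\<And>z. z \<in> polydisk \<Longrightarrow> (\<lambda>m. T (f m) z) \<longlonglongrightarrow> 0"
  obtains r where "strict_mono (r :: nat \<Rightarrow> nat)" "(\<lambda>m. Hinf_norm mu (T (f (r m)))) \<longlonglongrightarrow> 0"
proof -
  obtain r g where r: "strict_mono (r::nat\<Rightarrow>nat)" and g: "g \<in> Hinf mu"
    and lim: "(\<lambda>m. Hinf_norm mu (\<lambda>z. T (f (r m)) z - g z)) \<longlonglongrightarrow> 0"
    using comp f unfolding compact_op_def by blast
  have TH: "T (f m) \<in> Hinf mu" for m using comp f(1) by (auto simp: compact_op_def)
  have g0: "g z = 0" if z: "z \<in> polydisk" for z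
  proof -
    have "(\<lambda>m. mu z * cmod (T (f (r m)) z - g z)) \<longlonglongrightarrow> 0"
      using lim mu z by (intro tendsto_sandwich[OF _ _ tendsto_const lim] always_eventually allI
          Hinf_norm_upper Hinf_diff TH g) (auto simp: is_weight_def less_imp_le)
    moreover have "(\<lambda>m. mu z * cmod (T (f (r m)) z - g z)) \<longlonglongrightarrow> mu z * cmod (0 - g z)"
      using LIMSEQ_subseq_LIMSEQ[OF null[OF z] r] by (intro tendsto_intros) (simp add: o_def)
    ultimately have "mu z * cmod (0 - g z) = 0" using LIMSEQ_unique by blast
    then show ?thesis using mu z by (auto simp: is_weight_def)
  qed
  have "Hinf_norm mu (\<lambda>z. T (f (r m)) z - g z) = Hinf_norm mu (T (f (r m)))" for m
    unfolding Hinf_norm_def by (intro SUP_cong) (auto simp: g0)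
  with r lim that show thesis by simp
qed

lemma log_vanishing_if_compact_op:
  fixes phi :: "complex^'n::finite \<Rightarrow> complex^'n"
  assumes mu: "is_weight mu" and phi: "holo_selfmap phi"
    and comp: "compact_op bloch0star bloch_norm (Hinf mu) (Hinf_norm mu) (wcomp psi phi)"
  shows "log_vanishing mu psi phi"
  unfolding log_vanishing_def
proof (intro allI impI, elim conjE)
  fix s :: "nat \<Rightarrow> complex^'n"
  assume s: "\<forall>k. s k \<in> polydisk" and max1: "(\<lambda>k. Max (range (\<lambda>j. cmod (phi (s k) $ j)))) \<longlonglongrightarrow> 1"
  let ?X = "\<lambda>k. mu (s k) * cmod (psi (s k)) * bloch_log (phi (s k))"
  have ps: "phi (s k) \<in> polydisk" for k using s phi by (auto simp: holo_selfmap_def)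
  have "\<exists>j. cmod (phi (s k) $ j) = Max (range (\<lambda>j. cmod (phi (s k) $ j)))" for k
  proof -
    have "Max (range (\<lambda>j. cmod (phi (s k) $ j))) \<in> range (\<lambda>j. cmod (phi (s k) $ j))" by (intro Max_in) auto
    then show ?thesis by force
  qed
  then obtain J where J: "\<And>k. cmod (phi (s k) $ J k) = Max (range (\<lambda>j. cmod (phi (s k) $ j)))" by metis
  define w where "w k = phi (s k) $ J k" for k
  define L where "L k = - ln (1 - (cmod (w k))\<^sup>2)" for k
  have w1: "cmod (w k) < 1" for k using ps[of k] by (simp add: w_def polydisk_def)
  have pw: "phi (s k) \<in> closed_pd (cmod (w k))" for k by (simp add: closed_pd_def w_def J)
  have wlim: "(\<lambda>k. cmod (w k)) \<longlonglongrightarrow> 1" using max1 by (simp add: w_def J)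
  have "filterlim (\<lambda>k. 1 - (cmod (w k))\<^sup>2) (at_right 0) sequentially"
  proof -
    have "(\<lambda>k. 1 - (cmod (w k))\<^sup>2) \<longlonglongrightarrow> 1 - 1\<^sup>2" by (intro tendsto_intros wlim)
    moreover have "0 < 1 - (cmod (w k))\<^sup>2" for k using w1 by (simp add: abs_square_less_1)
    ultimately show ?thesis by (intro tendsto_imp_filterlim_at_right always_eventually) auto
  qed
  then have Llim: "filterlim L at_top sequentially"
    unfolding L_def[abs_def] filterlim_uminus_at_top[symmetric] 
    using filterlim_compose[OF ln_at_0] by (simp add: filterlim_uminus_at_bot)
  show "?X \<longlonglongrightarrow> 0"
  proof (rule ccontr)
    assume "\<not> ?X \<longlonglongrightarrow> 0"
    then obtain e where e: "0 < e" and nev: "\<not> (\<forall>\<^sub>F k in sequentially. dist (?X k) 0 < e)"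
      unfolding tendsto_iff by blast
    have "\<forall>\<^sub>F k in sequentially. 1 \<le> L k" using Llim by (simp add: filterlim_at_top)
    \<comment> \<open>Bad indices recur, and \<open>1 \<le> L k\<close> holds eventually; hence
      infinitely many indices are bad and also admit a normalised test function.\<close>
    then have "\<exists>\<^sub>F k in sequentially. e \<le> ?X k \<and> 1 \<le> L k"
    proof -
      have Xn: "0 \<le> ?X k" for k
        using mu s bloch_log_nonneg[OF ps[of k]] by (auto simp: is_weight_def less_imp_le)
      have "\<exists>\<^sub>F k in sequentially. \<not> dist (?X k) 0 < e" using nev by (simp add: frequently_def)
      from frequently_eventually_frequently[OF this \<open>\<forall>\<^sub>F k in sequentially. 1 \<le> L k\<close>]
      show ?thesis by (rule frequently_mono[rotated]) (use Xn in \<open>auto simp: not_less\<close>)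
    qed
    then have "infinite {k. e \<le> ?X k \<and> 1 \<le> L k}"
      by (simp add: frequently_cofinite flip: cofinite_eq_sequentially)
    then obtain r where r: "strict_mono (r::nat\<Rightarrow>nat)" "\<And>m. e \<le> ?X (r m)" "\<And>m. 1 \<le> L (r m)"
      using infinite_enumerate by blast
    note wr = w1 r(3)[unfolded L_def]
    let ?f = "\<lambda>m (z::complex^'n). log_test (w (r m)) (z $ J (r m))"
    obtain q where q: "strict_mono q" and lim: "(\<lambda>m. Hinf_norm mu (wcomp psi phi (?f (q m)))) \<longlonglongrightarrow> 0"
    proof (rule compact_op_pointwise_null[OF mu comp, of ?f])
      show "?f m \<in> bloch0star" "bloch_norm (?f m) \<le> 1" for m
        by (rule log_test_bloch0star[OF wr] log_test_bloch_norm[OF wr])+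
      fix z :: "complex^'n" assume z: "z \<in> polydisk"
      then have "phi z \<in> polydisk" using phi by (auto simp: holo_selfmap_def)
      then obtain a where a: "a < 1" "phi z \<in> interior (closed_pd a)"
        using polydisk_interior_closed_pd by metis
      then have "phi z \<in> closed_pd a" using interior_subset by blast
      then have le: "cmod (?f m (phi z)) \<le> (5 - ln (1 - a))\<^sup>2 / 28 * inverse (L (r m))" for m
        using log_test_le[OF wr _ a(1), of "phi z $ J (r m)" m] by (simp add: closed_pd_def L_def divide_simps)
      have "filterlim (\<lambda>m. L (r m)) at_top sequentially"
        by (rule filterlim_compose[OF Llim filterlim_subseq[OF r(1)]])
      then have "(\<lambda>m. (5 - ln (1 - a))\<^sup>2 / 28 * inverse (L (r m))) \<longlonglongrightarrow> (5 - ln (1 - a))\<^sup>2 / 28 * 0"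
        by (intro tendsto_intros tendsto_inverse_0_at_top)
      then have "(\<lambda>m. ?f m (phi z)) \<longlonglongrightarrow> 0"
        using le by (intro Lim_null_comparison[OF always_eventually[OF allI[OF le]]]) simp
      from tendsto_mult[OF tendsto_const[of "psi z"] this]
      show "(\<lambda>m. wcomp psi phi (?f m) z) \<longlonglongrightarrow> 0" by (simp add: wcomp_def)
    qed
    \<comment> \<open>The factor 56 is 2 from \<open>bloch_log_le_ln\<close> times 28 from
      \<open>log_test_self\<close>.\<close>
    have lower: "e \<le> 56 * CARD('n) * Hinf_norm mu (wcomp psi phi (?f (q m)))" for m
    proof -
      define k where "k = r (q m)"
      have A: "0 \<le> mu (s k) * cmod (psi (s k))" using mu s by (auto simp: is_weight_def less_imp_le)
      have H: "wcomp psi phi (?f (q m)) \<in> Hinf mu"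
        using comp log_test_bloch0star[OF wr] by (auto simp: compact_op_def)
      have "e \<le> ?X k" using r(2) by (simp add: k_def)
      also have "\<dots> \<le> mu (s k) * cmod (psi (s k)) * (2 * CARD('n) * L k)"
        using bloch_log_le_ln[OF wr pw, of "q m"] A by (intro mult_left_mono) (auto simp: k_def L_def)
      also have "\<dots> = 56 * CARD('n) * (mu (s k) * cmod (wcomp psi phi (?f (q m)) (s k)))"
        using log_test_self[OF wr, of "q m"] by (simp add: wcomp_def norm_mult k_def L_def flip: w_def)
      also have "\<dots> \<le> 56 * CARD('n) * Hinf_norm mu (wcomp psi phi (?f (q m)))"
        using Hinf_norm_upper[OF H] s by (intro mult_left_mono) auto
      finally show ?thesis .
    qed
    have lim': "(\<lambda>m. 56 * CARD('n) * Hinf_norm mu (wcomp psi phi (?f (q m)))) \<longlonglongrightarrow> 0"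
      by (rule tendsto_mult_right_zero[OF lim])
    have "e \<le> 0" by (rule LIMSEQ_le_const[OF lim']) (use lower in blast)
    with e show False by simp
  qed
qed

section \<open>The equivalence of the three conditions\<close>

lemma compact_op_subset:
  "X' \<subseteq> X \<Longrightarrow> compact_op X nX Y nY T \<Longrightarrow> compact_op X' nX Y nY T"
  unfolding compact_op_def by blast

theorem theorem5p3:
  fixes mu :: "complex^'n::finite \<Rightarrow> real"
    and psi :: "complex^'n \<Rightarrow> complex"
    and phi :: "complex^'n \<Rightarrow> complex^'n"
  assumes "is_weight mu" and "holo_pd psi" and "holo_selfmap phi"
  shows "(compact_op bloch_space bloch_norm (Hinf mu) (Hinf_norm mu) (wcomp psi phi)
            \<longleftrightarrow> compact_op bloch0star bloch_norm (Hinf mu) (Hinf_norm mu) (wcomp psi phi))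
       \<and> (compact_op bloch_space bloch_norm (Hinf mu) (Hinf_norm mu) (wcomp psi phi)
            \<longleftrightarrow> (psi \<in> Hinf mu \<and>
                 (\<forall>s::nat \<Rightarrow> complex^'n. (\<forall>k. s k \<in> polydisk) \<and>
                    (\<lambda>k. Max (range (\<lambda>j. cmod (phi (s k) $ j)))) \<longlonglongrightarrow> 1 \<longrightarrow>
                    (\<lambda>k. 1/2 * mu (s k) * cmod (psi (s k)) *
                       (\<Sum>j\<in>UNIV. ln ((1 + cmod (phi (s k) $ j)) / (1 - cmod (phi (s k) $ j)))))
                    \<longlonglongrightarrow> 0)))"
    (is "(?a \<longleftrightarrow> ?b) \<and> (?a \<longleftrightarrow> psi \<in> Hinf mu \<and> ?c)")
proof -
  have c: "?c \<longleftrightarrow> log_vanishing mu psi phi"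
    by (simp add: log_vanishing_def bloch_log_def)
  have ab: "?a \<Longrightarrow> ?b"
    by (rule compact_op_subset) (auto simp: bloch0star_def)
  have "psi \<in> Hinf mu" if ?b
  proof -
    have "wcomp psi phi (\<lambda>_. 1) \<in> Hinf mu"
      using that const_bloch0star unfolding compact_op_def by blast
    then show ?thesis by (simp add: wcomp_def)
  qed
  moreover have "?c" if ?b
    unfolding c by (rule log_vanishing_if_compact_op[OF assms(1,3) that])
  moreover have "?a" if "psi \<in> Hinf mu" "?c"
    using compact_op_bloch_if_log_vanishing[OF assms(1) that(1) assms(3)] that(2) unfolding c .
  ultimately show ?thesis using ab by blast
qed

end
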